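(* Let $G$ be a bipartite generalized polygon tree with at most three interior regions, formed as described in the context by paths $p_1,p_2,p_3,p_4,p_5,p_6$ of lengths $a,b,c,d,e,f$, respectively. Then $\mu(G)=1$ if and only if one of the following conditions holds: (1a) $a=b=c=d=e=f=2$; (1b) $a=b=e+f=2$ and $c=d=0$; (1c) $a=d=f=2$, $b=c=1$ and $e=0$; (1d) $a=d=f=2$, $b=c=2$ and $e=0$; (1e) $a=b=c=d=2$ and $e=f=0$. And $\mu(G)=3$ if and only if one of the following conditions holds: (3a) $a=b=c=d=0$ and $e+f\equiv 2\pmod 4$; (3b) $b=1$, $c=d=0$ and $a\equiv 1\pmod 4$, $e+f\equiv 1\pmod 4$; (3c) $b=1$, $e=f=0$ and $a,c,d\equiv 1\pmod 4$; (3d) $b=c=1$, $a,d,e\equiv 1\pmod 4$ and $f\equiv 3\pmod 4$. Otherwise $\mu(G)=2$.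
   Context: All graphs are finite and simple, and vertex-coloring edge-weightings are considered for connected graphs with at least three vertices. A $k$-edge-weighting of a graph $G$ is a function $w:E(G)\to\{1,2,\ldots,k\}$. It induces a vertex coloring $c$ by $c(v)=\sum_{e\sim v}w(e)$, where $e\sim v$ means that $e$ is an edge incident to $v$. If $c$ is a proper vertex coloring ($c(u)\neq c(v)$ for every two adjacent vertices $u,v$), then $w$ is called a vertex-coloring $k$-edge-weighting (VC$k$-EW). $\mu(G)$ denotes the minimum $k$ for which $G$ has a VC$k$-EW. A generalized polygon tree is a graph defined recursively: a cycle $C_p$ ($p\geq 3$) is a generalized polygon tree; and if $H$ is a generalized polygon tree containing a simple path $P_k$, $k\geq 1$, then any graph obtained from the union of $H$ and a cycle $C_r$, $r>k$, by identifying $P_k$ in $H$ with a path of length $k$ in $C_r$ is also a generalized polygon tree. The graph $G$ with path lengths $a,b,c,d,e,f\geq 0$ has four vertices $u,v,u',v'$ joined by internally disjoint paths: $p_1$ (length $a$) and $p_2$ (length $b$) join $u$ and $v$; $p_3$ (length $c$) and $p_4$ (length $d$) join $u'$ and $v'$; $p_5$ (length $e$) joins $u$ and $u'$; $p_6$ (length $f$) joins $v$ and $v'$. The three interior regions are bounded by $p_1\cup p_2$, by $p_2\cup p_5\cup p_3\cup p_6$, and by $p_3\cup p_4$. A path of length $0$ means that its two ends are identified; a path of positive length whose ends are thereby identified becomes a cycle of that length. For example, $c=d=0$ with the other paths nondegenerate gives three internally disjoint paths of lengths $a$, $b$, $e+f$ with common ends, and $a=b=c=d=0$ gives a cycle of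 length $e+f$.
   Formalization: The length conditions are required of some presentation of G by six such paths, not of the given a,…,f: taken literally the claim fails, e.g. K_{2,3} formed with a=b=0, c=d=2, e=f=1 has μ=1 but meets none of (1a)–(1e). *)

theory Defs
  imports Main
begin

record 'a ugraph =
  verts :: "'a set"
  edges :: "'a set set"

definition simple_graph :: "'a ugraph \<Rightarrow> bool" where
  "simple_graph G \<longleftrightarrow> finite (verts G) \<and> (\<forall>e\<in>edges G. e \<subseteq> verts G \<and> card e = 2)"

definition bipartite :: "'a ugraph \<Rightarrow> bool" where
  "bipartite G \<longleftrightarrow> (\<exists>A B. A \<union> B = verts G \<and> A \<inter> B = {} \<and>
     (\<forall>e\<in>edges G. \<exists>x\<in>A. \<exists>y\<in>B. e = {x, y}))"

definition induced_color :: "'a ugraph \<Rightarrow> ('a set \<Rightarrow> nat) \<Rightarrow> 'a \<Rightarrow> nat" where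
  "induced_color G w v = (\<Sum>e | e \<in> edges G \<and> v \<in> e. w e)"

definition vc_edge_weighting :: "'a ugraph \<Rightarrow> nat \<Rightarrow> ('a set \<Rightarrow> nat) \<Rightarrow> bool" where
  "vc_edge_weighting G k w \<longleftrightarrow> (\<forall>e\<in>edges G. w e \<in> {1..k}) \<and>
     (\<forall>u v. {u, v} \<in> edges G \<longrightarrow> induced_color G w u \<noteq> induced_color G w v)"

definition mu :: "'a ugraph \<Rightarrow> nat" where
  "mu G = (LEAST k. \<exists>w. vc_edge_weighting G k w)"

text \<open>Edges are listed with repetition, so that \<^const>\<open>distinct\<close> can detect parallel ones.\<close>

definition walk_edges :: "'a list \<Rightarrow> 'a set list" where
  "walk_edges xs = map (\<lambda>(x, y). {x, y}) (zip xs (tl xs))"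

definition inner_verts :: "'a list \<Rightarrow> 'a list" where
  "inner_verts xs = butlast (tl xs)"

definition simple_path :: "'a ugraph \<Rightarrow> nat \<Rightarrow> 'a list \<Rightarrow> bool" where
  "simple_path G k P \<longleftrightarrow> length P = Suc k \<and> distinct P \<and> set P \<subseteq> verts G \<and>
     set (walk_edges P) \<subseteq> edges G"

definition cycle_graph :: "nat \<Rightarrow> 'a ugraph \<Rightarrow> bool" where
  "cycle_graph r C \<longleftrightarrow> 3 \<le> r \<and> (\<exists>xs. length xs = r \<and> distinct xs \<and>
     C = \<lparr>verts = set xs, edges = set (walk_edges (xs @ [hd xs]))\<rparr>)"

text \<open>The first argument counts the cycles used in the construction, which is the number of
  interior regions. Identification of a path is rendered as a union of two graphs that meet
  exactly in that path; the condition on the edges ensures that, when \<open>r = k + 1\<close>, the new edge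
  is not parallel to an edge of \<open>H\<close>, so that the result is again a simple graph.\<close>

inductive gen_polygon_tree :: "nat \<Rightarrow> 'a ugraph \<Rightarrow> bool" where
  cycle: "cycle_graph p C \<Longrightarrow> gen_polygon_tree 1 C"
| glue: "\<lbrakk>gen_polygon_tree n H; simple_path H k P; 1 \<le> k;
     cycle_graph r C; k < r; simple_path C k P;
     verts H \<inter> verts C = set P; edges H \<inter> edges C = set (walk_edges P)\<rbrakk>
   \<Longrightarrow> gen_polygon_tree (Suc n) \<lparr>verts = verts H \<union> verts C, edges = edges H \<union> edges C\<rparr>"

datatype corner = Corner_u | Corner_v | Corner_u' | Corner_v'

definition skeleton :: "nat \<Rightarrow> nat \<Rightarrow> nat \<Rightarrow> nat \<Rightarrow> nat \<Rightarrow> nat \<Rightarrow> (corner \<times> corner \<times> nat) list" where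
  "skeleton a b c d e f =
     [(Corner_u, Corner_v, a), (Corner_u, Corner_v, b),
      (Corner_u', Corner_v', c), (Corner_u', Corner_v', d),
      (Corner_u, Corner_u', e), (Corner_v, Corner_v', f)]"

text \<open>\<open>G\<close> is made up of the six paths. The map \<open>x\<close> places the corners; two corners coincide
  exactly when paths of length 0 force them to. A path of positive length with coinciding ends
  is a closed walk. Distinctness of the list of all edges says that no two edges of the figure
  become parallel (in particular, no cycle of length 2 arises), as \<open>G\<close> is simple.\<close>

definition formed_by_paths ::
    "'a ugraph \<Rightarrow> nat \<Rightarrow> nat \<Rightarrow> nat \<Rightarrow> nat \<Rightarrow> nat \<Rightarrow> nat \<Rightarrow> bool" where
  "formed_by_paths G a b c d e f \<longleftrightarrow> (\<exists>(x :: corner \<Rightarrow> 'a) ps.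
     list_all2 (\<lambda>(i, j, l) p. length p = Suc l \<and> hd p = x i \<and> last p = x j)
       (skeleton a b c d e f) ps \<and>
     (\<forall>i j. x i = x j \<longleftrightarrow> equivclp (\<lambda>i j. (i, j, 0) \<in> set (skeleton a b c d e f)) i j) \<and>
     distinct (concat (map inner_verts ps)) \<and>
     set (concat (map inner_verts ps)) \<inter> range x = {} \<and>
     distinct (concat (map walk_edges ps)) \<and>
     verts G = (\<Union>p\<in>set ps. set p) \<and>
     edges G = set (concat (map walk_edges ps)))"

definition mu_one_lengths :: "nat \<Rightarrow> nat \<Rightarrow> nat \<Rightarrow> nat \<Rightarrow> nat \<Rightarrow> nat \<Rightarrow> bool" where
  "mu_one_lengths a b c d e f \<longleftrightarrow>
     (a = 2 \<and> b = 2 \<and> c = 2 \<and> d = 2 \<and> e = 2 \<and> f = 2) \<or>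
     (a = 2 \<and> b = 2 \<and> e + f = 2 \<and> c = 0 \<and> d = 0) \<or>
     (a = 2 \<and> d = 2 \<and> f = 2 \<and> b = 1 \<and> c = 1 \<and> e = 0) \<or>
     (a = 2 \<and> d = 2 \<and> f = 2 \<and> b = 2 \<and> c = 2 \<and> e = 0) \<or>
     (a = 2 \<and> b = 2 \<and> c = 2 \<and> d = 2 \<and> e = 0 \<and> f = 0)"

definition mu_three_lengths :: "nat \<Rightarrow> nat \<Rightarrow> nat \<Rightarrow> nat \<Rightarrow> nat \<Rightarrow> nat \<Rightarrow> bool" where
  "mu_three_lengths a b c d e f \<longleftrightarrow>
     (a = 0 \<and> b = 0 \<and> c = 0 \<and> d = 0 \<and> (e + f) mod 4 = 2) \<or>
     (b = 1 \<and> c = 0 \<and> d = 0 \<and> a mod 4 = 1 \<and> (e + f) mod 4 = 1) \<or>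
     (b = 1 \<and> e = 0 \<and> f = 0 \<and> a mod 4 = 1 \<and> c mod 4 = 1 \<and> d mod 4 = 1) \<or>
     (b = 1 \<and> c = 1 \<and> a mod 4 = 1 \<and> d mod 4 = 1 \<and> e mod 4 = 1 \<and> f mod 4 = 3)"

text \<open>The lengths are not determined by the graph: the figure is symmetric, and if paths degenerate
  further relabellings arise. For instance the complete bipartite graph with parts of sizes 2 and 3
  is formed by the lengths \<open>2, 2, 0, 0, 1, 1\<close> as well as by \<open>0, 0, 2, 2, 1, 1\<close>. The conditions on
  the lengths are conditions on the graph, understood up to the naming of the paths: some
  presentation of the graph by six paths satisfies them.\<close>

definition presented_with ::
    "'a ugraph \<Rightarrow> (nat \<Rightarrow> nat \<Rightarrow> nat \<Rightarrow> nat \<Rightarrow> nat \<Rightarrow> nat \<Rightarrow> bool) \<Rightarrow> bool" where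
  "presented_with G Q \<longleftrightarrow> (\<exists>a b c d e f. formed_by_paths G a b c d e f \<and> Q a b c d e f)"

end

theory Submission
  imports Defs "HOL-Library.Multiset"
begin

text \<open>
  The graph is nonseparable: a cycle is, and so is a union of two nonseparable graphs that share an
  edge. A path whose ends coincide is therefore the whole graph, and of all figures that the six
  paths can form only five remain (\<open>formed_by_paths_cases\<close>): a cycle; three or four paths with
  common ends; two pairs of parallel paths pinched together at one corner of degree four; and the
  figure with four corners of degree three.

  In such a figure only the corners interact. An inner vertex of a path has the sum of two
  consecutive weights as its colour, so two adjacent inner vertices differ exactly if the weights
  \<open>w\<^sub>i\<close> and \<open>w\<^sub>i\<^sub>+\<^sub>2\<close> differ. A weighting thus amounts to a choice of the two end weights of every path,
  subject to one condition per path (\<open>link\<close>) that sees the rest of the graph only through the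
  colours of the two corners (\<open>weightable_iff_links\<close>).

  With the single weight 1 a path of length at least 3 is impossible, and the degrees together with
  the bipartition leave only paths of length 2. With the weights 1 and 2 the condition becomes
  \<open>w\<^sub>i\<^sub>+\<^sub>2 = 3 - w\<^sub>i\<close>. Hence a path of length 1 modulo 4 has equal end weights, a path of length 3
  modulo 4 has different ones, and a path of even length leaves both ends free. This gives the
  obstruction. If a figure consists of paths of length 1 modulo 4 between two corners, both corners
  get the same colour, and none of the paths can be a single edge. In the figure with four corners of degree
  three, an edge in a pair of paths of lengths 1 modulo 4 forces the two remaining paths at its ends
  to start with different weights; if this happens at both pairs, then the two connecting paths
  cannot have lengths 1 and 3 modulo 4. A cycle of length 2 modulo 4 fails since the recurrence does
  not close up.

  In all other cases two weights suffice. The weights of two parallel paths are chosen as a unit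
  (\<open>bigon\<close>): for given sums \<open>P\<close>, \<open>Q\<close> of the other weights at the two ends, a short table lists the
  sums \<open>\<alpha>\<close>, \<open>\<beta>\<close> that the pair can contribute. The shapes are assembled from these tables; large
  contributions make the corner colours exceed those of their neighbours on long paths, and only the
  colours of adjacent corners have to be told apart. In the exceptional cases a third weight
  breaks the tie: it is used on one edge, or on two consecutive edges of a cycle.
\<close>

section \<open>Generalized polygon trees are nonseparable\<close>

text \<open>Two-connectedness in terms of edges: no single vertex separates an edge set from its
  complement.\<close>

definition nonseparable :: "'a ugraph \<Rightarrow> bool" where
  "nonseparable G \<longleftrightarrow> (\<forall>E F. E \<union> F = edges G \<and> E \<inter> F = {} \<and> E \<noteq> {} \<and> F \<noteq> {} \<longrightarrow>
     (\<exists>x y. x \<noteq> y \<and> {x, y} \<subseteq> \<Union>E \<inter> \<Union>F))"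

lemma length_walk_edges [simp]: "length (walk_edges p) = length p - 1"
  by (simp add: walk_edges_def)

lemma nth_walk_edges: "Suc i < length p \<Longrightarrow> walk_edges p ! i = {p ! i, p ! Suc i}"
  by (simp add: walk_edges_def nth_tl)

lemma walk_edges_Nil [simp]: "walk_edges [] = []"
  and walk_edges_single [simp]: "walk_edges [x] = []"
  and walk_edges_Cons_Cons [simp]: "walk_edges (x # y # p) = {x, y} # walk_edges (y # p)"
  by (simp_all add: walk_edges_def)

lemma set_walk_edges: "set (walk_edges p) = {{p ! i, p ! Suc i} | i. Suc i < length p}"
  by (auto simp: in_set_conv_nth less_diff_conv nth_walk_edges)
    (metis Suc_eq_plus1 less_diff_conv nth_walk_edges)+

lemma Union_walk_edges: "2 \<le> length p \<Longrightarrow> \<Union> (set (walk_edges p)) = set p"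
proof (induction p rule: induct_list012)
  case (3 x y zs)
  then show ?case by (cases zs) auto
qed auto

lemma change_of_truth:
  fixes P :: "nat \<Rightarrow> bool"
  assumes "P i" "\<not> P j" "i \<le> j"
  shows "\<exists>t. P t \<and> \<not> P (Suc t)"
  using assms(3,2,1) by (induction rule: dec_induct) blast+

text \<open>The edges of a cycle are indexed by all natural numbers, with period the length, so that walking
  around the cycle needs no special case at the closing edge.\<close>

lemma set_walk_edges_closed:
  assumes "0 < length xs"
  shows "set (walk_edges (xs @ [hd xs])) =
    range (\<lambda>i. {xs ! (i mod length xs), xs ! (Suc i mod length xs)})" (is "_ = range ?e")
proof -
  have *: "{(xs @ [hd xs]) ! i, (xs @ [hd xs]) ! Suc i} = ?e i" if "i < length xs" for i
    using that assms by (cases "Suc i = length xs") (auto simp: nth_append hd_conv_nth)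
  have "?e i = ?e (i mod length xs)" for i
    by (simp add: mod_Suc_eq)
  moreover have "i mod length xs < length xs" for i
    using assms by simp
  ultimately have "?e i \<in> ?e ` {..<length xs}" for i
    by (intro image_eqI[of _ _ "i mod length xs"]) auto
  then have "range ?e = ?e ` {..<length xs}"
    by blast
  moreover have "set (walk_edges (xs @ [hd xs])) =
      (\<lambda>i. {(xs @ [hd xs]) ! i, (xs @ [hd xs]) ! Suc i}) ` {..<length xs}"
    by (auto simp: set_walk_edges)
  ultimately show ?thesis
    using * by (simp cong: image_cong_simp)
qed

text \<open>Going around the cycle one passes from the first edge set to the second and back again. The two
  vertices of passage differ, because equal positions modulo the length have the same outgoing
  edge.\<close>

lemma cycle_graph_nonseparable:
  assumes "cycle_graph r C"
  shows "nonseparable C" "verts C = \<Union> (edges C)" "edges C \<noteq> {}"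
proof -
  obtain xs where xs: "length xs = r" "distinct xs" "3 \<le> r"
    and C: "C = \<lparr>verts = set xs, edges = set (walk_edges (xs @ [hd xs]))\<rparr>"
    using assms unfolding cycle_graph_def by blast
  define y where "y i = xs ! (i mod r)" for i
  have E: "edges C = range (\<lambda>i. {y i, y (Suc i)})"
    using set_walk_edges_closed[of xs] xs by (auto simp: C y_def)
  have "\<Union> (edges C) = set (xs @ [hd xs])"
    using Union_walk_edges[of "xs @ [hd xs]"] xs by (auto simp: C)
  then show "verts C = \<Union> (edges C)"
    using xs by (cases xs) (auto simp: C)
  show "edges C \<noteq> {}"
    by (simp add: E)
  show "nonseparable C"
    unfolding nonseparable_def
  proof (intro allI impI, elim conjE)
    fix A B assume AB: "A \<union> B = edges C" "A \<inter> B = {}" "A \<noteq> {}" "B \<noteq> {}"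
    define inA where "inA i \<longleftrightarrow> {y i, y (Suc i)} \<in> A" for i
    have B: "\<not> inA i \<Longrightarrow> {y i, y (Suc i)} \<in> B" for i
      using AB(1) by (auto simp: inA_def E)
    have period: "inA (i + r * m) = inA i" for i m
      by (simp add: inA_def y_def flip: add_Suc)
    have idx: "\<exists>i. e = {y i, y (Suc i)}" if "e \<in> A \<union> B" for e
      using that unfolding AB(1) E by blast
    obtain e e' where e: "e \<in> A" "e' \<in> B"
      using AB(3,4) by blast
    obtain i j where ij: "e = {y i, y (Suc i)}" "e' = {y j, y (Suc j)}"
      using idx[of e] idx[of e'] e by blast
    have i: "inA i" and j: "\<not> inA j"
      using e ij AB(2) unfolding inA_def by blast+
    have "1 \<le> r" using xs by simp
    have "i \<le> j + r * i" "j \<le> i + r * j"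
      using mult_le_mono1[OF \<open>1 \<le> r\<close>, of i] mult_le_mono1[OF \<open>1 \<le> r\<close>, of j] by linarith+
    then obtain s t where s: "inA s" "\<not> inA (Suc s)" and t: "\<not> inA t" "inA (Suc t)"
      using change_of_truth[of inA i "j + r * i"] change_of_truth[of "\<lambda>i. \<not> inA i" j "i + r * j"]
        i j period by auto
    have "y (Suc s) \<noteq> y (Suc t)"
    proof
      assume "y (Suc s) = y (Suc t)"
      then have "Suc s mod r = Suc t mod r"
        using xs by (simp add: y_def nth_eq_iff_index_eq)
      then have "Suc (Suc s) mod r = Suc (Suc t) mod r"
        by (metis mod_Suc_eq)
      then show False
        using s(2) t(2) \<open>Suc s mod r = Suc t mod r\<close> by (simp add: inA_def y_def)
    qed
    moreover have "{y (Suc s), y (Suc t)} \<subseteq> \<Union>A \<inter> \<Union>B"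
      using s t B[of "Suc s"] B[of t] unfolding inA_def by blast
    ultimately show "\<exists>x y. x \<noteq> y \<and> {x, y} \<subseteq> \<Union>A \<inter> \<Union>B"
      by blast
  qed
qed

text \<open>If neither graph is split by the given partition, then each lies on one side, and the common edge
  puts them on the same side.\<close>

lemma nonseparable_union:
  assumes H: "nonseparable H" and C: "nonseparable C" and e: "e \<in> edges H \<inter> edges C"
    and G: "edges G = edges H \<union> edges C"
  shows "nonseparable G"
  unfolding nonseparable_def
proof (intro allI impI, elim conjE)
  fix A B assume AB: "A \<union> B = edges G" "A \<inter> B = {}" "A \<noteq> {}" "B \<noteq> {}"
  have *: "\<exists>x y. x \<noteq> y \<and> {x, y} \<subseteq> \<Union>A \<inter> \<Union>B"
    if K: "nonseparable K" "edges K \<subseteq> edges G" and split: "A \<inter> edges K \<noteq> {}" "B \<inter> edges K \<noteq> {}"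
    for K :: "'a ugraph"
  proof -
    have "A \<inter> edges K \<union> B \<inter> edges K = edges K" "(A \<inter> edges K) \<inter> (B \<inter> edges K) = {}"
      using AB K(2) by auto
    then obtain x y where "x \<noteq> y" "{x, y} \<subseteq> \<Union>(A \<inter> edges K) \<inter> \<Union>(B \<inter> edges K)"
      using K(1) split unfolding nonseparable_def by meson
    then show ?thesis by blast
  qed
  have "A \<inter> edges H \<noteq> {} \<and> B \<inter> edges H \<noteq> {} \<or> A \<inter> edges C \<noteq> {} \<and> B \<inter> edges C \<noteq> {}"
    using AB e G by blast
  then show "\<exists>x y. x \<noteq> y \<and> {x, y} \<subseteq> \<Union>A \<inter> \<Union>B"
    using *[OF H] *[OF C] G by blast
qed

lemma gen_polygon_tree_nonseparable:
  assumes "gen_polygon_tree n G"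
  shows "nonseparable G \<and> verts G = \<Union> (edges G) \<and> edges G \<noteq> {}"
  using assms
proof induction
  case (cycle p C)
  then show ?case using cycle_graph_nonseparable by blast
next
  case (glue n H k P r C)
  have "walk_edges P \<noteq> []"
    using glue.hyps by (auto simp: simple_path_def simp flip: length_0_conv)
  then obtain e where "e \<in> edges H \<inter> edges C"
    using glue.hyps by (metis list.set_intros(1) neq_Nil_conv)
  then show ?case
    using glue.IH cycle_graph_nonseparable[OF \<open>cycle_graph r C\<close>]
      nonseparable_union[of H C e] by auto
qed

section \<open>Subdivisions of multigraphs\<close>

lemma length_inner_verts [simp]: "length (inner_verts p) = length p - 2"
  by (simp add: inner_verts_def)

lemma nth_inner_verts: "i < length p - 2 \<Longrightarrow> inner_verts p ! i = p ! Suc i"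
  by (simp add: inner_verts_def nth_butlast nth_tl)

lemma path_split: "2 \<le> length p \<Longrightarrow> p = hd p # inner_verts p @ [last p]"
  unfolding inner_verts_def
  by (cases p; cases "tl p") auto

lemma inner_verts_Cons_snoc [simp]: "inner_verts (x # xs @ [y]) = xs"
  by (simp add: inner_verts_def)

lemma inner_verts_rev [simp]: "inner_verts (rev p) = rev (inner_verts p)"
  by (metis inner_verts_def butlast_rev butlast_tl rev_rev_ident)

lemma walk_edges_append:
  "p \<noteq> [] \<Longrightarrow> q \<noteq> [] \<Longrightarrow> walk_edges (p @ q) = walk_edges p @ {last p, hd q} # walk_edges q"
  by (induction p rule: induct_list012) (auto simp: neq_Nil_conv)

lemma walk_edges_rev [simp]: "walk_edges (rev p) = rev (walk_edges p)"
proof (induction p rule: induct_list012)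
  case (3 x y zs)
  then show ?case
    using walk_edges_append[of "rev zs @ [y]" "[x]"] by (simp add: insert_commute)
qed auto

text \<open>Paths that meet at most in their ends. As the edges are listed with repetition, distinctness
  excludes parallel edges and, for a closed path, length 2.\<close>

definition path_system :: "'a ugraph \<Rightarrow> 'a list list \<Rightarrow> bool" where
  "path_system G ps \<longleftrightarrow> (\<forall>p\<in>set ps. 2 \<le> length p) \<and>
     distinct (concat (map inner_verts ps)) \<and>
     (\<forall>p\<in>set ps. {hd p, last p} \<inter> set (concat (map inner_verts ps)) = {}) \<and>
     distinct (concat (map walk_edges ps)) \<and>
     edges G = set (concat (map walk_edges ps))"

definition traces :: "'a \<times> 'a \<times> nat \<Rightarrow> 'a list \<Rightarrow> bool" where
  "traces = (\<lambda>(i, j, l) p. length p = Suc l \<and> hd p = i \<and> last p = j)"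

text \<open>The multigraph is a list of edges, each with the length of the path that replaces it. Its
  vertices are those of the graph itself, so that coinciding corners need no separate map.\<close>

definition subdivision :: "'a ugraph \<Rightarrow> ('a \<times> 'a \<times> nat) list \<Rightarrow> bool" where
  "subdivision G sk \<longleftrightarrow> (\<exists>ps. path_system G ps \<and> list_all2 traces sk ps)"

lemma distinct_concat_map_mset:
  assumes "mset ps = mset qs"
  shows "distinct (concat (map f ps)) \<longleftrightarrow> distinct (concat (map f qs))"
proof -
  have "mset (concat (map f xs)) = sum_mset (image_mset (mset \<circ> f) (mset xs))" for xs
    by (induction xs) auto
  then show ?thesis using assms by (metis mset_eq_imp_distinct_iff)
qed

lemma path_system_mset:
  assumes "path_system G ps" "mset ps = mset qs"
  shows "path_system G qs"
  using assms(1) mset_eq_setD[OF assms(2)] distinct_concat_map_mset[OF assms(2), of inner_verts]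
    distinct_concat_map_mset[OF assms(2), of walk_edges]
  by (simp add: path_system_def)

lemma subdivision_mset:
  assumes "subdivision G sk" "mset sk = mset sk'"
  shows "subdivision G sk'"
proof -
  obtain ps where ps: "path_system G ps" "list_all2 traces sk ps"
    using assms by (auto simp: subdivision_def)
  obtain qs where "list_all2 traces sk' qs" "mset qs = mset ps"
    using list_all2_reorder_left_invariance[OF ps(2), of sk'] assms(2) by auto
  then show ?thesis
    using path_system_mset[OF ps(1)] by (metis subdivision_def)
qed

lemma subdivision_reverse:
  assumes "subdivision G ((i, j, l) # sk)"
  shows "subdivision G ((j, i, l) # sk)"
proof -
  obtain p ps where p: "path_system G (p # ps)" "list_all2 traces sk ps" "traces (i, j, l) p"
    using assms by (auto simp: subdivision_def list_all2_Cons1)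
  have "path_system G (rev p # ps)"
    using p(1) unfolding path_system_def
    by (auto simp: hd_rev last_rev)
  moreover have "traces (j, i, l) (rev p)"
    using p(3) by (auto simp: traces_def hd_rev last_rev)
  ultimately show ?thesis
    using p(2) by (auto simp: subdivision_def)
qed

text \<open>The paths of the multigraph have no direction.\<close>

lemma subdivision_orient:
  assumes "list_all2 (\<lambda>(i, j, l) t. t = (i, j, l) \<or> t = (j, i, l)) sk sk'" "subdivision G sk"
  shows "subdivision G sk'"
proof -
  have "subdivision G (xs @ sk')" if "subdivision G (xs @ sk)" for xs
    using assms(1) that
  proof (induction arbitrary: xs rule: list_all2_induct)
    case (Cons t sk t' sk')
    obtain i j l where t: "t = (i, j, l)" by (cases t)
    have "subdivision G ((i, j, l) # xs @ sk)"
      using Cons.prems by (rule subdivision_mset) (simp add: t)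
    then have "subdivision G (t' # xs @ sk)"
      using Cons.hyps subdivision_reverse by (auto simp: t)
    then have "subdivision G ((xs @ [t']) @ sk)"
      by (rule subdivision_mset) simp
    then have "subdivision G ((xs @ [t']) @ sk')"
      by (rule Cons.IH)
    then show ?case by simp
  qed
  from this[of "[]"] show ?thesis
    using assms(2) by simp
qed

lemma subdivision_pos:
  assumes "subdivision G sk"
  shows "\<forall>(i, j, l)\<in>set sk. 0 < l"
proof -
  obtain ps where ps: "path_system G ps" "list_all2 traces sk ps"
    using assms(1) by (auto simp: subdivision_def)
  have "\<forall>p\<in>set ps. 2 \<le> length p"
    using ps(1) by (simp add: path_system_def)
  with ps(2) show ?thesis
    by (induction rule: list_all2_induct) (auto simp: traces_def)
qed

text \<open>A corner of degree two can be suppressed.\<close>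

lemma subdivision_join:
  assumes "subdivision G ((i, j, l) # (j, k, m) # sk)" "i \<noteq> j" "k \<noteq> j"
    and "\<forall>(x, y, n)\<in>set sk. x \<noteq> j \<and> y \<noteq> j"
  shows "subdivision G ((i, k, l + m) # sk)"
proof -
  obtain p q ps where ps: "path_system G (p # q # ps)" "list_all2 traces sk ps"
    and p: "length p = Suc l" "hd p = i" "last p = j" and q: "length q = Suc m" "hd q = j" "last q = k"
    using assms(1) by (auto simp: subdivision_def list_all2_Cons1 traces_def)
  have "2 \<le> length p" "2 \<le> length q"
    using ps(1) by (auto simp: path_system_def)
  then obtain xs ys where p': "p = i # xs @ [j]" and q': "q = j # ys @ [k]"
    by (rule that[OF path_split[of p, unfolded p(2,3)] path_split[of q, unfolded q(2,3)]])
  have ends: "hd r \<noteq> j \<and> last r \<noteq> j" if "r \<in> set ps" for r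
  proof -
    obtain n where "n < length ps" "r = ps ! n"
      using \<open>r \<in> set ps\<close> by (auto simp: in_set_conv_nth)
    then have "sk ! n \<in> set sk" "traces (sk ! n) r"
      using ps(2) by (auto simp: list_all2_conv_all_nth)
    then show ?thesis using assms(4) by (cases "sk ! n") (auto simp: traces_def)
  qed
  define r where "r = i # (xs @ j # ys) @ [k]"
  have inner: "inner_verts r = xs @ j # ys"
    by (simp only: r_def inner_verts_Cons_snoc)
  have r: "walk_edges r = walk_edges p @ walk_edges q"
    "hd r = i" "last r = k" "length r = Suc (l + m)"
    using p(1) q(1) walk_edges_append[of "i # xs" "[j]"] walk_edges_append[of "i # xs" "j # ys @ [k]"]
    by (simp_all add: r_def p' q')
  have "path_system G (r # ps)"
    using ps(1) ends inner r p(1) q(1) assms(2,3) unfolding path_system_def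
    by (auto simp: p' q')
  then show ?thesis
    using ps(2) r by (auto simp: subdivision_def traces_def intro!: exI[of _ "r # ps"])
qed

text \<open>The edges of a closed path and the remaining edges can share only the vertex at which the path
  closes, and nonseparability asks for two shared vertices.\<close>

lemma closed_path_alone:
  assumes "nonseparable G" "subdivision G sk" "(i, i, l) \<in> set sk"
  shows "sk = [(i, i, l)]"
proof -
  obtain sk' where sk': "mset sk = mset ((i, i, l) # sk')"
    using assms(3) by (metis ex_mset insert_DiffM mset.simps(2) set_mset_mset)
  then have "subdivision G ((i, i, l) # sk')"
    using assms(2) subdivision_mset by blast
  then obtain p ps where ps: "path_system G (p # ps)" "list_all2 traces sk' ps"
    and p: "hd p = i" "last p = i"
    by (auto simp: subdivision_def list_all2_Cons1 traces_def)
  have len: "2 \<le> length q" if "q \<in> set (p # ps)" for q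
    using ps(1) that by (auto simp: path_system_def)
  have set_eq: "set q = {hd q, last q} \<union> set (inner_verts q)" if "q \<in> set (p # ps)" for q
    by (subst path_split[OF len[OF that]]) auto
  have "ps = []"
  proof (rule ccontr)
    assume "ps \<noteq> []"
    let ?A = "set (walk_edges p)" and ?B = "set (concat (map walk_edges ps))"
    have "walk_edges q \<noteq> []" if "q \<in> set (p # ps)" for q
      using len[OF that] by (auto simp flip: length_0_conv)
    then have "?A \<noteq> {}" "?B \<noteq> {}"
      using \<open>ps \<noteq> []\<close> by (auto simp: neq_Nil_conv)
    moreover have "?A \<union> ?B = edges G" "?A \<inter> ?B = {}"
      using ps(1) by (auto simp: path_system_def)
    ultimately have "\<exists>x y. x \<noteq> y \<and> {x, y} \<subseteq> \<Union>?A \<inter> \<Union>?B"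
      by (intro assms(1)[unfolded nonseparable_def, rule_format] conjI)
    then obtain x y where xy: "x \<noteq> y" "{x, y} \<subseteq> \<Union>?A \<inter> \<Union>?B"
      by metis
    have "\<Union>?B = (\<Union>q\<in>set ps. \<Union>(set (walk_edges q)))"
      by auto
    also have "\<dots> = (\<Union>q\<in>set ps. set q)"
      by (intro SUP_cong refl Union_walk_edges len) simp
    finally have "\<Union>?A \<inter> \<Union>?B = set p \<inter> (\<Union>q\<in>set ps. set q)"
      using Union_walk_edges[of p] len by simp
    also have "\<dots> \<subseteq> {i}"
    proof
      fix z assume "z \<in> set p \<inter> (\<Union>q\<in>set ps. set q)"
      then obtain q where "q \<in> set ps" "z \<in> set p" "z \<in> set q" by blast
      then show "z \<in> {i}"
        using ps(1) set_eq[of p] set_eq[of q] p unfolding path_system_def by auto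
    qed
    finally show False using xy by blast
  qed
  then have "sk' = []"
    using ps(2) by simp
  then show ?thesis
    using sk' by simp
qed

section \<open>Presentations by six paths\<close>

text \<open>The skeleton seen in the graph: its corners become vertices, and the paths of length 0, which have
  no edges, disappear.\<close>

definition placed :: "('c \<Rightarrow> 'a) \<Rightarrow> ('c \<times> 'c \<times> nat) list \<Rightarrow> ('a \<times> 'a \<times> nat) list" where
  "placed x sk = filter (\<lambda>(i, j, l). 0 < l) (map (\<lambda>(i, j, l). (x i, x j, l)) sk)"

lemma concat_filter_trivial:
  "concat (map inner_verts (filter (\<lambda>p. 2 \<le> length p) ps)) = concat (map inner_verts ps)"
  "concat (map walk_edges (filter (\<lambda>p. 2 \<le> length p) ps)) = concat (map walk_edges ps)"
proof (induction ps)
  case (Cons p ps)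
  have "inner_verts p = [] \<and> walk_edges p = []" if "\<not> 2 \<le> length p"
    using that by (simp flip: length_0_conv)
  then show "concat (map inner_verts (filter (\<lambda>p. 2 \<le> length p) (p # ps)))
      = concat (map inner_verts (p # ps))"
    and "concat (map walk_edges (filter (\<lambda>p. 2 \<le> length p) (p # ps)))
      = concat (map walk_edges (p # ps))"
    using Cons by auto
qed auto

lemma list_all2_traces_placed:
  assumes "list_all2 (\<lambda>(i, j, l) p. length p = Suc l \<and> hd p = x i \<and> last p = x j) sk ps"
  shows "list_all2 traces (placed x sk) (filter (\<lambda>p. 2 \<le> length p) ps)"
  using assms by (induction rule: list_all2_induct) (auto simp: placed_def traces_def)

text \<open>Converse to \<open>list_all2_traces_placed\<close>: the paths of length 0 are recovered as one-vertex lists at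
  the corners that they identify.\<close>

lemma insert_trivial_paths:
  assumes "list_all2 traces (placed x sk) ps" "\<And>i j. (i, j, 0) \<in> set sk \<Longrightarrow> x i = x j"
  shows "\<exists>qs. list_all2 (\<lambda>(i, j, l) p. length p = Suc l \<and> hd p = x i \<and> last p = x j) sk qs \<and>
    filter (\<lambda>p. 2 \<le> length p) qs = ps"
  using assms
proof (induction sk arbitrary: ps)
  case (Cons t sk)
  obtain i j l where t: "t = (i, j, l)" by (cases t)
  show ?case
  proof (cases "l = 0")
    case True
    then have "list_all2 traces (placed x sk) ps" "x i = x j"
      using Cons.prems t by (auto simp: placed_def)
    then obtain qs where "list_all2 (\<lambda>(i, j, l) p. length p = Suc l \<and> hd p = x i \<and> last p = x j) sk qs"
        "filter (\<lambda>p. 2 \<le> length p) qs = ps"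
      using Cons by (meson list.set_intros(2))
    then show ?thesis
      using \<open>x i = x j\<close> True by (intro exI[of _ "[x i] # qs"]) (simp add: t)
  next
    case False
    then obtain p ps' where ps: "ps = p # ps'" "traces (x i, x j, l) p"
        "list_all2 traces (placed x sk) ps'"
      using Cons.prems t by (auto simp: placed_def list_all2_Cons1)
    then obtain qs where "list_all2 (\<lambda>(i, j, l) p. length p = Suc l \<and> hd p = x i \<and> last p = x j) sk qs"
        "filter (\<lambda>p. 2 \<le> length p) qs = ps'"
      using Cons by (meson list.set_intros(2))
    then show ?thesis
      using ps False by (intro exI[of _ "p # qs"]) (simp add: t traces_def)
  qed
qed (simp add: placed_def)

lemma formed_by_paths_subdivision:
  assumes "formed_by_paths G a b c d e f"
  obtains x where
    "\<forall>i j. x i = x j \<longleftrightarrow> equivclp (\<lambda>i j. (i, j, 0) \<in> set (skeleton a b c d e f)) i j"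
    "subdivision G (placed x (skeleton a b c d e f))"
proof -
  obtain x ps where all: "list_all2 (\<lambda>(i, j, l) p. length p = Suc l \<and> hd p = x i \<and> last p = x j)
       (skeleton a b c d e f) ps"
    and x: "\<forall>i j. x i = x j \<longleftrightarrow> equivclp (\<lambda>i j. (i, j, 0) \<in> set (skeleton a b c d e f)) i j"
    and ps: "distinct (concat (map inner_verts ps))"
     "set (concat (map inner_verts ps)) \<inter> range x = {}"
     "distinct (concat (map walk_edges ps))"
     "edges G = set (concat (map walk_edges ps))"
    using assms unfolding formed_by_paths_def by (elim exE conjE) (rule that)
  let ?qs = "filter (\<lambda>p. 2 \<le> length p) ps"
  have ends: "\<forall>p\<in>set ps. {hd p, last p} \<subseteq> range x"
    using all by (induction rule: list_all2_induct) auto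
  have "{hd p, last p} \<inter> set (concat (map inner_verts ps)) = {}" if "p \<in> set ps" for p
    using ends that ps(2) by blast
  then have "path_system G ?qs"
    unfolding path_system_def concat_filter_trivial using ps by (simp del: set_concat)
  then show thesis
    using list_all2_traces_placed[OF all] x by (intro that) (auto simp: subdivision_def)
qed

lemma equivclp_kernel:
  assumes "equivclp R i j" "\<And>i j. R i j \<Longrightarrow> x i = x j"
  shows "x i = x j"
  using assms(1) by (induction rule: equivclp_induct) (auto dest: assms(2))

text \<open>The condition that corners coincide only when paths of length 0 force them to is checked through
  a representative of each class. The last assumption rules out a corner that no edge reaches.\<close>

lemma formed_by_pathsI:
  assumes zero: "\<And>i j. (i, j, 0) \<in> set (skeleton a b c d e f) \<Longrightarrow> x i = x j"
    and rep: "\<And>i. equivclp (\<lambda>i j. (i, j, 0) \<in> set (skeleton a b c d e f)) i (rep i)"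
    and inj: "\<And>i j. x i = x j \<Longrightarrow> rep i = rep j"
    and sub: "subdivision G (placed x (skeleton a b c d e f))"
    and G: "verts G = \<Union> (edges G)"
    and corners: "range x \<subseteq> (\<Union>(i, j, l)\<in>set (placed x (skeleton a b c d e f)). {i, j})"
  shows "formed_by_paths G a b c d e f"
proof -
  obtain ps where ps: "path_system G ps" "list_all2 traces (placed x (skeleton a b c d e f)) ps"
    using sub by (auto simp: subdivision_def)
  let ?R = "\<lambda>i j. (i, j, 0) \<in> set (skeleton a b c d e f)"
  have x: "x i = x j \<longleftrightarrow> equivclp ?R i j" for i j
  proof
    assume "x i = x j"
    then have "rep i = rep j" by (rule inj)
    have "equivclp ?R (rep i) j"
      unfolding \<open>rep i = rep j\<close> by (rule equivclp_sym[OF rep])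
    then show "equivclp ?R i j" by (rule equivclp_trans[OF rep])
  next
    assume "equivclp ?R i j"
    then show "x i = x j" by (rule equivclp_kernel) (rule zero)
  qed
  obtain qs where qs: "list_all2 (\<lambda>(i, j, l) p. length p = Suc l \<and> hd p = x i \<and> last p = x j)
      (skeleton a b c d e f) qs" "filter (\<lambda>p. 2 \<le> length p) qs = ps"
    using insert_trivial_paths[OF ps(2)] zero by (auto intro: that)
  have "(\<Union>(i, j, l)\<in>set sk. {i, j}) = (\<Union>p\<in>set ps. {hd p, last p})" if "list_all2 traces sk ps"
    for sk :: "('a \<times> 'a \<times> nat) list" and ps
    using that by (induction rule: list_all2_induct) (auto simp: traces_def)
  note ends = this[OF ps(2)]
  have "(\<Union>p\<in>set ps. set p) = (\<Union>p\<in>set ps. \<Union>(set (walk_edges p)))"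
    using ps(1) by (intro SUP_cong refl Union_walk_edges[symmetric]) (auto simp: path_system_def)
  also have "\<dots> = verts G"
    using ps(1) by (auto simp: path_system_def G)
  finally have verts: "(\<Union>p\<in>set ps. set p) = verts G" .
  have hl: "hd p \<in> set p \<and> last p \<in> set p" if "p \<in> set ps" for p
    using ps(1) that by (cases p) (auto simp: path_system_def)
  note rx = corners[unfolded ends]
  have "(\<Union>p\<in>set ps. {hd p, last p}) \<subseteq> (\<Union>p\<in>set ps. set p)"
    using hl by (intro UN_mono) auto
  then have "range x \<subseteq> verts G"
    unfolding verts by (rule order_trans[OF rx])
  have qs_sub: "set q \<subseteq> (\<Union>p\<in>set ps. set p) \<union> range x" if "q \<in> set qs" for q
  proof (cases "2 \<le> length q")
    case True
    then show ?thesis using that qs(2) by auto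
  next
    case False
    have "\<forall>q\<in>set qs. q \<noteq> [] \<and> hd q \<in> range x"
      using qs(1) by (induction rule: list_all2_induct) auto
    then show ?thesis using False that by (cases q; cases "tl q") auto
  qed
  have "set ps \<subseteq> set qs"
    using qs(2) by auto
  then have "verts G \<subseteq> (\<Union>q\<in>set qs. set q)"
    unfolding verts[symmetric] by (rule UN_mono) simp
  moreover have "(\<Union>q\<in>set qs. set q) \<subseteq> verts G"
    using qs_sub \<open>range x \<subseteq> verts G\<close> unfolding verts by (intro UN_least) blast
  ultimately have "verts G = (\<Union>q\<in>set qs. set q)"
    by (rule equalityI)
  moreover have "set (concat (map inner_verts ps)) \<inter> (\<Union>p\<in>set ps. {hd p, last p}) = {}"
    using ps(1) unfolding path_system_def by (simp del: set_concat) blast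
  then have "set (concat (map inner_verts qs)) \<inter> range x = {}"
    using rx concat_filter_trivial(1)[of qs] unfolding qs(2) by (simp del: set_concat) blast
  ultimately show ?thesis
    unfolding formed_by_paths_def using qs(1) x ps(1) concat_filter_trivial[of qs]
    by (intro exI[of _ x] exI[of _ qs]) (simp add: path_system_def qs(2) del: set_concat)
qed

lemma equivclp_skeleton:
  "equivclp (\<lambda>i j. (i, j, 0) \<in> set (skeleton a b 0 d e f)) Corner_v' Corner_u'"
  "equivclp (\<lambda>i j. (i, j, 0) \<in> set (skeleton a b c d 0 f)) Corner_u' Corner_u"
  "equivclp (\<lambda>i j. (i, j, 0) \<in> set (skeleton a b c d e 0)) Corner_v' Corner_v"
  by (intro equivclp_sym[OF r_into_equivclp]; simp add: skeleton_def)+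

text \<open>One presentation is fixed for each shape. Zero lengths are placed so that the conditions of the
  classification can be read off directly.\<close>

lemma formed_by_paths_cycle:
  assumes G: "verts G = \<Union> (edges G)" and sub: "subdivision G [(u, u, n)]"
  shows "formed_by_paths G 0 0 0 0 0 n"
proof (rule formed_by_pathsI[where x = "\<lambda>_. u" and rep = "\<lambda>_. Corner_u"])
  have "0 < n" using subdivision_pos[OF sub] by simp
  then show "subdivision G (placed (\<lambda>_. u) (skeleton 0 0 0 0 0 n))"
    "range (\<lambda>_. u) \<subseteq> (\<Union>(i, j, l)\<in>set (placed (\<lambda>_. u) (skeleton 0 0 0 0 0 n)). {i, j})"
    using sub by (auto simp: placed_def skeleton_def)
  fix i
  have "equivclp (\<lambda>i j. (i, j, 0) \<in> set (skeleton 0 0 0 0 0 n)) Corner_v Corner_u"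
    by (intro equivclp_sym[OF r_into_equivclp]) (simp add: skeleton_def)
  then show "equivclp (\<lambda>i j. (i, j, 0) \<in> set (skeleton 0 0 0 0 0 n)) i Corner_u"
    using equivclp_trans[OF equivclp_skeleton(1,2)] equivclp_skeleton(2) equivclp_refl
    by (cases i) auto
qed (auto simp: G)

lemma formed_by_paths_theta:
  assumes G: "verts G = \<Union> (edges G)" and sub: "subdivision G [(u, v, a), (u, v, b), (u, v, n)]"
    and "u \<noteq> v"
  shows "formed_by_paths G a b 0 0 0 n"
proof -
  define x where "x = case_corner u v u u"
  define rep where "rep = case_corner Corner_u Corner_v Corner_u Corner_u"
  have pos: "0 < a" "0 < b" "0 < n" using subdivision_pos[OF sub] by simp_all
  show ?thesis
  proof (rule formed_by_pathsI[of _ _ _ _ _ _ x rep])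
    have "subdivision G [(u, v, a), (u, v, b), (v, u, n)]"
      by (rule subdivision_orient[OF _ sub]) simp
    then show "subdivision G (placed x (skeleton a b 0 0 0 n))"
      using pos by (simp add: placed_def skeleton_def x_def)
    show "range x \<subseteq> (\<Union>(i, j, l)\<in>set (placed x (skeleton a b 0 0 0 n)). {i, j})"
      using pos by (auto simp: placed_def skeleton_def x_def split: corner.splits)
    show "equivclp (\<lambda>i j. (i, j, 0) \<in> set (skeleton a b 0 0 0 n)) i (rep i)" for i
      using equivclp_trans[OF equivclp_skeleton(1,2)] equivclp_skeleton(2) equivclp_refl
      by (cases i) (auto simp: rep_def)
    show "x i = x j \<Longrightarrow> rep i = rep j" for i j
      using \<open>u \<noteq> v\<close> by (auto simp: x_def rep_def split: corner.splits)
    show "(i, j, 0) \<in> set (skeleton a b 0 0 0 n) \<Longrightarrow> x i = x j" for i j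
      using pos by (auto simp: skeleton_def x_def)
  qed (fact G)
qed

lemma formed_by_paths_theta4:
  assumes G: "verts G = \<Union> (edges G)"
    and sub: "subdivision G [(u, v, a), (u, v, b), (u, v, c), (u, v, d)]"
    and "u \<noteq> v"
  shows "formed_by_paths G a b c d 0 0"
proof -
  define x where "x = case_corner u v u v"
  define rep where "rep = case_corner Corner_u Corner_v Corner_u Corner_v"
  have pos: "0 < a" "0 < b" "0 < c" "0 < d" using subdivision_pos[OF sub] by simp_all
  show ?thesis
  proof (rule formed_by_pathsI[of _ _ _ _ _ _ x rep])
    show "subdivision G (placed x (skeleton a b c d 0 0))"
      using pos sub by (simp add: placed_def skeleton_def x_def)
    show "range x \<subseteq> (\<Union>(i, j, l)\<in>set (placed x (skeleton a b c d 0 0)). {i, j})"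
      using pos by (auto simp: placed_def skeleton_def x_def split: corner.splits)
    show "equivclp (\<lambda>i j. (i, j, 0) \<in> set (skeleton a b c d 0 0)) i (rep i)" for i
      using equivclp_skeleton(2,3) equivclp_refl by (cases i) (auto simp: rep_def)
    show "x i = x j \<Longrightarrow> rep i = rep j" for i j
      using \<open>u \<noteq> v\<close> by (auto simp: x_def rep_def split: corner.splits)
    show "(i, j, 0) \<in> set (skeleton a b c d 0 0) \<Longrightarrow> x i = x j" for i j
      using pos by (auto simp: skeleton_def x_def)
  qed (fact G)
qed

lemma formed_by_paths_pinched:
  assumes G: "verts G = \<Union> (edges G)"
    and sub: "subdivision G [(u, v, a), (u, v, b), (u, w, c), (u, w, d), (v, w, f)]"
    and "distinct [u, v, w]"
  shows "formed_by_paths G a b c d 0 f"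
proof -
  define x where "x = case_corner u v u w"
  define rep where "rep = case_corner Corner_u Corner_v Corner_u Corner_v'"
  have pos: "0 < a" "0 < b" "0 < c" "0 < d" "0 < f" using subdivision_pos[OF sub] by simp_all
  show ?thesis
  proof (rule formed_by_pathsI[of _ _ _ _ _ _ x rep])
    show "subdivision G (placed x (skeleton a b c d 0 f))"
      using pos sub by (simp add: placed_def skeleton_def x_def)
    show "range x \<subseteq> (\<Union>(i, j, l)\<in>set (placed x (skeleton a b c d 0 f)). {i, j})"
      using pos by (auto simp: placed_def skeleton_def x_def split: corner.splits)
    show "equivclp (\<lambda>i j. (i, j, 0) \<in> set (skeleton a b c d 0 f)) i (rep i)" for i
      using equivclp_skeleton(2) equivclp_refl by (cases i) (auto simp: rep_def)
    show "x i = x j \<Longrightarrow> rep i = rep j" for i j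
      using \<open>distinct [u, v, w]\<close> by (auto simp: x_def rep_def split: corner.splits)
    show "(i, j, 0) \<in> set (skeleton a b c d 0 f) \<Longrightarrow> x i = x j" for i j
      using pos by (auto simp: skeleton_def x_def)
  qed (fact G)
qed

lemma formed_by_paths_full:
  assumes G: "verts G = \<Union> (edges G)"
    and sub: "subdivision G [(u, v, a), (u, v, b), (u', v', c), (u', v', d), (u, u', e), (v, v', f)]"
    and "distinct [u, v, u', v']"
  shows "formed_by_paths G a b c d e f"
proof -
  define x where "x = case_corner u v u' v'"
  have pos: "0 < a" "0 < b" "0 < c" "0 < d" "0 < e" "0 < f" using subdivision_pos[OF sub] by simp_all
  show ?thesis
  proof (rule formed_by_pathsI[of _ _ _ _ _ _ x "\<lambda>i. i"])
    show "subdivision G (placed x (skeleton a b c d e f))"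
      using pos sub by (simp add: placed_def skeleton_def x_def)
    show "range x \<subseteq> (\<Union>(i, j, l)\<in>set (placed x (skeleton a b c d e f)). {i, j})"
      using pos by (auto simp: placed_def skeleton_def x_def split: corner.splits)
    show "x i = x j \<Longrightarrow> i = j" for i j
      using \<open>distinct [u, v, u', v']\<close> by (auto simp: x_def split: corner.splits)
    show "(i, j, 0) \<in> set (skeleton a b c d e f) \<Longrightarrow> x i = x j" for i j
      using pos by (auto simp: skeleton_def)
  qed (simp_all add: G)
qed

text \<open>If some path of positive length is closed, it is the whole graph. Otherwise \<open>u\<close> and \<open>v\<close> coincide
  exactly if both \<open>a\<close> and \<open>b\<close> vanish, and likewise for the other pair. Where a pair vanishes, the
  paths \<open>p\<^sub>5\<close> and \<open>p\<^sub>6\<close> join to a single path.\<close>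

lemma formed_by_paths_cases:
  assumes formed: "formed_by_paths G a b c d e f" and ns: "nonseparable G" and ne: "edges G \<noteq> {}"
  obtains (cycle) u where "a = 0 \<or> b = 0" "subdivision G [(u, u, a + b + c + d + e + f)]"
  | (theta) u v where "u \<noteq> v" "0 < a" "0 < b" "c = 0" "d = 0"
      "subdivision G [(u, v, a), (u, v, b), (u, v, e + f)]"
  | (theta') u v where "u \<noteq> v" "a = 0" "b = 0" "0 < c" "0 < d"
      "subdivision G [(u, v, c), (u, v, d), (u, v, e + f)]"
  | (theta4) u v where "u \<noteq> v" "0 < a" "0 < b" "0 < c" "0 < d" "e = 0" "f = 0"
      "subdivision G [(u, v, a), (u, v, b), (u, v, c), (u, v, d)]"
  | (pinched) u v w where "distinct [u, v, w]" "0 < a" "0 < b" "0 < c" "0 < d"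
      "e = 0 \<and> 0 < f \<or> 0 < e \<and> f = 0"
      "subdivision G [(u, v, a), (u, v, b), (u, w, c), (u, w, d), (v, w, e + f)]"
  | (full) u v u' v' where "distinct [u, v, u', v']"
      "0 < a" "0 < b" "0 < c" "0 < d" "0 < e" "0 < f"
      "subdivision G [(u, v, a), (u, v, b), (u', v', c), (u', v', d), (u, u', e), (v, v', f)]"
proof -
  let ?sk = "skeleton a b c d e f"
  obtain x where x: "\<forall>i j. x i = x j \<longleftrightarrow> equivclp (\<lambda>i j. (i, j, 0) \<in> set ?sk) i j"
    and sub: "subdivision G (placed x ?sk)"
    using formed by (rule formed_by_paths_subdivision)
  define u v u' v' where uv: "u = x Corner_u" "v = x Corner_v" "u' = x Corner_u'" "v' = x Corner_v'"
  have sk: "placed x ?sk = filter (\<lambda>(i, j, l). 0 < l)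
      [(u, v, a), (u, v, b), (u', v', c), (u', v', d), (u, u', e), (v, v', f)]"
    by (simp add: placed_def skeleton_def uv)
  have zero: "x i = x j" if "(i, j, 0) \<in> set ?sk" for i j
    using that x by (simp add: r_into_equivclp)
  have eq: "a = 0 \<Longrightarrow> u = v" "b = 0 \<Longrightarrow> u = v" "c = 0 \<Longrightarrow> u' = v'" "d = 0 \<Longrightarrow> u' = v'"
    "e = 0 \<Longrightarrow> u = u'" "f = 0 \<Longrightarrow> v = v'"
    unfolding uv by (rule zero; simp add: skeleton_def)+
  show thesis
  proof (cases "\<exists>y l. (y, y, l) \<in> set (placed x ?sk)")
    case True
    then obtain y l where y: "placed x ?sk = [(y, y, l)]"
      using closed_path_alone[OF ns sub] by blast
    have "sum_list (map (\<lambda>(i, j, l). l) (placed x ?sk)) = a + b + c + d + e + f"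
      by (simp add: sk)
    then have "l = a + b + c + d + e + f"
      by (simp add: y)
    moreover have "a = 0 \<or> b = 0"
      using y unfolding sk by (auto split: if_splits)
    ultimately show thesis
      using cycle sub y by auto
  next
    case False
    then have loop: "\<not> (0 < l \<and>
        (y, y, l) \<in> set [(u, v, a), (u, v, b), (u', v', c), (u', v', d), (u, u', e), (v, v', f)])"
      for y l
    proof -
      have "(y, y, l) \<notin> set (placed x ?sk)"
        using False by simp
      then show ?thesis
        unfolding sk by (simp only: set_filter mem_Collect_eq split_conv) (simp only: conj_commute not_False_eq_True)
    qed
    have neq: "0 < a \<Longrightarrow> u \<noteq> v" "0 < b \<Longrightarrow> u \<noteq> v" "0 < c \<Longrightarrow> u' \<noteq> v'" "0 < d \<Longrightarrow> u' \<noteq> v'"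
      "0 < e \<Longrightarrow> u \<noteq> u'" "0 < f \<Longrightarrow> v \<noteq> v'"
      using loop[of a u] loop[of b u] loop[of c u'] loop[of d u'] loop[of e u] loop[of f v]
      by auto
    have ab: "a = 0 \<longleftrightarrow> b = 0" and cd: "c = 0 \<longleftrightarrow> d = 0"
      using eq neq by auto
    show thesis
    proof (cases "a = 0"; cases "c = 0")
      assume 0: "a = 0" "c = 0"
      have "e \<noteq> 0 \<or> f \<noteq> 0"
      proof (rule ccontr)
        assume "\<not> ?thesis"
        then have "subdivision G []" using sub 0 ab cd unfolding sk by simp
        then show False using ne by (simp add: subdivision_def path_system_def)
      qed
      then have pos: "0 < e" "0 < f"
        using 0 eq neq by auto
      then have "subdivision G [(u, u', e), (u, u', f)]"
        using sub 0 ab cd eq unfolding sk by simp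
      then have "subdivision G [(u, u', e), (u', u, f)]"
        by (rule subdivision_orient[rotated]) simp
      then have "subdivision G [(u, u, e + f)]"
        using neq pos by (intro subdivision_join[of G u u' e u f "[]"]) auto
      then show thesis
        using cycle 0 ab cd by simp
    next
      assume 0: "a \<noteq> 0" "c = 0"
      have eq': "u' = v'" using eq 0 by simp
      have "u \<noteq> v" using neq 0 by simp
      have "subdivision G [(u, v, a), (u, v, b), (u, v, e + f)]"
      proof (cases "e = 0"; cases "f = 0")
        assume "e = 0" "f \<noteq> 0"
        then have "subdivision G [(u, v, a), (u, v, b), (v, u, f)]"
          using sub 0 ab cd eq unfolding sk by simp
        then have "subdivision G [(u, v, a), (u, v, b), (u, v, f)]"
          by (rule subdivision_orient[rotated]) simp
        then show ?thesis using \<open>e = 0\<close> by simp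
      next
        assume "e \<noteq> 0" "f = 0"
        then show ?thesis
          using sub 0 ab cd eq unfolding sk by simp
      next
        assume "e \<noteq> 0" "f \<noteq> 0"
        then have "subdivision G [(u, v, a), (u, v, b), (u, u', e), (v, u', f)]"
          using sub 0 ab cd eq' unfolding sk by simp
        then have "subdivision G [(u, v, a), (u, v, b), (u, u', e), (u', v, f)]"
          by (rule subdivision_orient[rotated]) simp
        then have "subdivision G [(u, u', e), (u', v, f), (u, v, a), (u, v, b)]"
          by (rule subdivision_mset) simp
        then have "subdivision G [(u, v, e + f), (u, v, a), (u, v, b)]"
          using neq \<open>e \<noteq> 0\<close> \<open>f \<noteq> 0\<close> eq' by (intro subdivision_join[of G u u']) auto
        then show ?thesis by (rule subdivision_mset) simp
      next
        assume "e = 0" "f = 0"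
        then show ?thesis using eq eq' \<open>u \<noteq> v\<close> by simp
      qed
      then show thesis
        using theta 0 ab cd neq by auto
    next
      assume 0: "a = 0" "c \<noteq> 0"
      have eq': "u = v" using eq 0 by simp
      have "u' \<noteq> v'" using neq 0 by simp
      have "subdivision G [(u', v', c), (u', v', d), (u', v', e + f)]"
      proof (cases "e = 0"; cases "f = 0")
        assume "e = 0" "f \<noteq> 0"
        then show ?thesis
          using sub 0 ab cd eq unfolding sk by simp
      next
        assume "e \<noteq> 0" "f = 0"
        then have "subdivision G [(u', v', c), (u', v', d), (v', u', e)]"
          using sub 0 ab cd eq eq' unfolding sk by simp
        then have "subdivision G [(u', v', c), (u', v', d), (u', v', e)]"
          by (rule subdivision_orient[rotated]) simp
        then show ?thesis using \<open>f = 0\<close> by simp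
      next
        assume "e \<noteq> 0" "f \<noteq> 0"
        then have "subdivision G [(u', v', c), (u', v', d), (u, u', e), (u, v', f)]"
          using sub 0 ab cd eq' unfolding sk by simp
        then have "subdivision G [(u', v', c), (u', v', d), (u', u, e), (u, v', f)]"
          by (rule subdivision_orient[rotated]) simp
        then have "subdivision G [(u', u, e), (u, v', f), (u', v', c), (u', v', d)]"
          by (rule subdivision_mset) simp
        then have "subdivision G [(u', v', e + f), (u', v', c), (u', v', d)]"
          using neq \<open>e \<noteq> 0\<close> \<open>f \<noteq> 0\<close> eq' by (intro subdivision_join[of G u' u]) auto
        then show ?thesis by (rule subdivision_mset) simp
      next
        assume "e = 0" "f = 0"
        then show ?thesis using eq eq' \<open>u' \<noteq> v'\<close> by simp
      qed
      then show thesis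
        using theta' 0 ab cd neq by auto
    next
      assume 0: "a \<noteq> 0" "c \<noteq> 0"
      show thesis
      proof (cases "e = 0"; cases "f = 0")
        assume ef: "e = 0" "f = 0"
        then show thesis
          using theta4[of u v] sub 0 ab cd eq neq unfolding sk by simp
      next
        assume ef: "e = 0" "f \<noteq> 0"
        then show thesis
          using pinched[of u v v'] sub 0 ab cd eq neq unfolding sk by simp
      next
        assume ef: "e \<noteq> 0" "f = 0"
        then have "subdivision G [(u, v, a), (u, v, b), (u', v, c), (u', v, d), (u, u', e)]"
          using sub 0 ab cd eq unfolding sk by simp
        then have "subdivision G [(v, u, a), (v, u, b), (v, u', c), (v, u', d), (u, u', e)]"
          by (rule subdivision_orient[rotated]) simp
        then show thesis
          using pinched[of v u u'] ef 0 ab cd eq neq by auto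
      next
        assume ef: "e \<noteq> 0" "f \<noteq> 0"
        have "(i, j, 0) \<notin> set ?sk" for i j
          using 0 ab cd ef by (simp add: skeleton_def)
        then have "i = j" if "equivclp (\<lambda>i j. (i, j, 0) \<in> set ?sk) i j" for i j
          by (intro equivclp_kernel[OF that, of "\<lambda>i. i"]) simp
        then have "i = j" if "x i = x j" for i j
          using x that by simp
        then have "inj x"
          by (rule injI)
        then have "distinct [u, v, u', v']"
          unfolding uv by (simp add: inj_eq)
        then show thesis
          using full[of u v u' v'] sub 0 ab cd ef unfolding sk by simp
      qed
    qed
  qed
qed

section \<open>Path lengths in simple and in bipartite graphs\<close>

text \<open>The side of the bipartition changes with every edge of a path.\<close>

lemma subdivision_parity:
  assumes "subdivision G sk" "bipartite G"
  shows "\<exists>s. \<forall>(i, j, l)\<in>set sk. (s i \<longleftrightarrow> s j) \<longleftrightarrow> even l"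
proof -
  obtain A B where AB: "A \<inter> B = {}" "\<forall>e\<in>edges G. \<exists>x\<in>A. \<exists>y\<in>B. e = {x, y}"
    using assms(2) by (auto simp: bipartite_def)
  obtain ps where ps: "path_system G ps" "list_all2 traces sk ps"
    using assms(1) by (auto simp: subdivision_def)
  have par: "(hd p \<in> A \<longleftrightarrow> last p \<in> A) \<longleftrightarrow> even (length p - 1)" if "p \<in> set ps" for p
  proof -
    have "p ! i \<in> A \<longleftrightarrow> p ! Suc i \<notin> A" if "Suc i < length p" for i
    proof -
      have "{p ! i, p ! Suc i} \<in> edges G"
        using ps(1) \<open>p \<in> set ps\<close> that unfolding path_system_def
        by (auto simp: set_walk_edges)
      then show ?thesis
        using AB by (fastforce simp: doubleton_eq_iff)
    qed
    then have "i < length p \<Longrightarrow> (p ! 0 \<in> A \<longleftrightarrow> p ! i \<in> A) \<longleftrightarrow> even i" for i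
      by (induction i) auto
    moreover have "p \<noteq> []"
      using ps(1) that by (auto simp: path_system_def)
    ultimately show ?thesis
      by (simp add: hd_conv_nth last_conv_nth)
  qed
  have "list_all2 (\<lambda>t p. traces t p \<and> ((hd p \<in> A \<longleftrightarrow> last p \<in> A) \<longleftrightarrow> even (length p - 1))) sk ps"
    using ps(2) par by (simp add: list_all2_conv_all_nth)
  then have "\<forall>(i, j, l)\<in>set sk. (i \<in> A \<longleftrightarrow> j \<in> A) \<longleftrightarrow> even l"
    by (induction rule: list_all2_induct) (auto simp: traces_def)
  then show ?thesis by (rule exI[of _ "\<lambda>x. x \<in> A"])
qed

lemma path_length_one: "length p = Suc 1 \<Longrightarrow> p = [hd p, last p]"
  by (auto simp: length_Suc_conv)

lemma no_parallel_edges: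
  assumes "subdivision G ((i, j, l) # (i, j, m) # sk)"
  shows "l \<noteq> 1 \<or> m \<noteq> 1"
proof (rule ccontr)
  assume "\<not> ?thesis"
  then obtain p q ps where "path_system G (p # q # ps)" "p = [i, j]" "q = [i, j]"
    using assms path_length_one
    by (fastforce simp: subdivision_def list_all2_Cons1 traces_def)
  then show False by (auto simp: path_system_def)
qed

lemma edge_card: "simple_graph G \<Longrightarrow> {x, y} \<in> edges G \<Longrightarrow> x \<noteq> y"
  by (fastforce simp: simple_graph_def)

lemma closed_path_length:
  assumes "subdivision G [(u, u, n)]" "simple_graph G"
  shows "3 \<le> n"
proof (rule ccontr)
  assume n: "\<not> 3 \<le> n"
  obtain p where p: "path_system G [p]" "length p = Suc n" "hd p = u" "last p = u"
    using assms by (auto simp: subdivision_def list_all2_Cons1 traces_def)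
  have "0 < n"
    using subdivision_pos[OF assms(1)] by simp
  with n consider "n = 1" | "n = 2" by linarith
  then show False
  proof cases
    case 1
    then have "p = [u, u]" using p path_length_one[of p] by simp
    then have "{u, u} \<in> edges G"
      using p(1) by (simp add: path_system_def)
    then show False
      using edge_card[OF assms(2), of u u] by simp
  next
    case 2
    then obtain x where "p = [u, x, u]"
      using p by (auto simp: numeral_2_eq_2 length_Suc_conv)
    then show False
      using p(1) by (auto simp: path_system_def insert_commute)
  qed
qed

section \<open>From weightings to end weights\<close>

text \<open>The weights \<open>g 0, \<dots>, g (l - 1)\<close> on a path of length \<open>l\<close> whose ends are coloured \<open>S\<close> and \<open>T\<close>. The
  second conjunct compares adjacent inner vertices, which share one edge, and the last one compares
  each end with its neighbour on the path; for \<open>l = 1\<close> the ends are each other's neighbours.\<close>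

definition proper_along :: "nat \<Rightarrow> nat \<Rightarrow> (nat \<Rightarrow> nat) \<Rightarrow> nat \<Rightarrow> nat \<Rightarrow> bool" where
  "proper_along k l g S T \<longleftrightarrow> (\<forall>i<l. g i \<in> {1..k}) \<and> (\<forall>i. i + 2 < l \<longrightarrow> g i \<noteq> g (i + 2)) \<and>
     (if l = 1 then S \<noteq> T else S \<noteq> g 0 + g 1 \<and> T \<noteq> g (l - 2) + g (l - 1))"

text \<open>All that the rest of the graph sees of a weighted path: the weights \<open>x\<close> and \<open>y\<close> of its first and
  last edge.\<close>

definition link :: "nat \<Rightarrow> nat \<Rightarrow> nat \<Rightarrow> nat \<Rightarrow> nat \<Rightarrow> nat \<Rightarrow> bool" where
  "link k l x y S T \<longleftrightarrow> (\<exists>g. proper_along k l g S T \<and> g 0 = x \<and> g (l - 1) = y)"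

lemma proper_along_colors:
  fixes C :: "nat \<Rightarrow> nat"
  assumes "0 < l" "\<And>i. 0 < i \<Longrightarrow> i < l \<Longrightarrow> C i = g (i - 1) + g i"
  shows "proper_along k l g (C 0) (C l) \<longleftrightarrow>
    (\<forall>i<l. g i \<in> {1..k}) \<and> (\<forall>i<l. C i \<noteq> C (Suc i))"
proof (cases "l = 1")
  case False
  then obtain m where m: "l = Suc (Suc m)"
    using assms(1) by (metis One_nat_def gr0_implies_Suc old.nat.exhaust)
  have C: "C (Suc i) = g i + g (Suc i)" if "i \<le> m" for i
    using assms(2)[of "Suc i"] that by (simp add: m)
  have "(\<forall>i<l. C i \<noteq> C (Suc i)) \<longleftrightarrow>
      C 0 \<noteq> C 1 \<and> (\<forall>i<m. C (Suc i) \<noteq> C (Suc (Suc i))) \<and> C (Suc m) \<noteq> C l"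
    unfolding m All_less_Suc2[of "Suc m"] All_less_Suc[of m] by auto
  also have "\<dots> \<longleftrightarrow> C 0 \<noteq> g 0 + g 1 \<and> (\<forall>i<m. g i \<noteq> g (i + 2)) \<and> C l \<noteq> g m + g (Suc m)"
    using C by (auto simp: eval_nat_numeral)
  finally show ?thesis
    by (auto simp: proper_along_def m)
qed (simp add: proper_along_def)

definition weight_at :: "('a set \<Rightarrow> nat) \<Rightarrow> 'a list \<Rightarrow> nat \<Rightarrow> nat" where
  "weight_at w p i = w {p ! i, p ! Suc i}"

definition path_color :: "('a set \<Rightarrow> nat) \<Rightarrow> 'a list \<Rightarrow> 'a \<Rightarrow> nat" where
  "path_color w p v = (\<Sum>e\<leftarrow>walk_edges p. if v \<in> e then w e else 0)"

lemma induced_color_path_color: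
  assumes "path_system G ps"
  shows "induced_color G w v = (\<Sum>p\<leftarrow>ps. path_color w p v)"
proof -
  let ?es = "concat (map walk_edges ps)"
  have es: "distinct ?es" "edges G = set ?es"
    using assms by (auto simp: path_system_def)
  have "induced_color G w v = (\<Sum>e | e \<in> set ?es \<and> v \<in> e. w e)"
    by (simp only: induced_color_def es(2))
  also have "\<dots> = (\<Sum>e\<in>set ?es. if v \<in> e then w e else 0)"
    by (rule sum.mono_neutral_cong_left) (auto simp del: set_concat)
  also have "\<dots> = (\<Sum>e\<leftarrow>?es. if v \<in> e then w e else 0)"
    by (rule sum.distinct_set_conv_list[OF es(1)])
  also have "\<dots> = (\<Sum>p\<leftarrow>ps. path_color w p v)"
    by (induction ps) (simp_all add: path_color_def)
  finally show ?thesis .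
qed

text \<open>Every edge of the path is charged to its two ends, and then the charges are collected by vertex.
  Done this way, no case distinction is needed for closed paths or for paths of length 1.\<close>

lemma path_color_eq:
  assumes "length p = Suc l" "0 < l" "\<And>i. i < l \<Longrightarrow> p ! i \<noteq> p ! Suc i"
  shows "path_color w p v =
    (if hd p = v then weight_at w p 0 else 0) + (if last p = v then weight_at w p (l - 1) else 0) +
    (\<Sum>i = 1..<l. if p ! i = v then weight_at w p (i - 1) + weight_at w p i else 0)"
proof -
  let ?g = "weight_at w p"
  obtain m where m: "l = Suc m" using assms(2) gr0_implies_Suc by blast
  have "p \<noteq> []" using assms(1) by auto
  have "walk_edges p = map (\<lambda>i. {p ! i, p ! Suc i}) [0..<l]"
    using assms(1) by (intro nth_equalityI) (auto simp: nth_walk_edges)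
  then have "path_color w p v = (\<Sum>i<l. if v \<in> {p ! i, p ! Suc i} then ?g i else 0)"
    by (simp add: path_color_def weight_at_def comp_def interv_sum_list_conv_sum_set_nat
        atLeast0LessThan cong: if_cong)
  also have "\<dots> = (\<Sum>i<l. (if p ! i = v then ?g i else 0) + (if p ! Suc i = v then ?g i else 0))"
  proof (rule sum.cong)
    fix i assume "i \<in> {..<l}"
    then show "(if v \<in> {p ! i, p ! Suc i} then ?g i else 0) =
        (if p ! i = v then ?g i else 0) + (if p ! Suc i = v then ?g i else 0)"
      using assms(3)[of i] by auto
  qed simp
  also have "\<dots> = (\<Sum>i<l. if p ! i = v then ?g i else 0) +
      (\<Sum>i<l. if p ! Suc i = v then ?g i else 0)"
    by (rule sum.distrib)
  also have "(\<Sum>i<l. if p ! i = v then ?g i else 0) =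
      (if hd p = v then ?g 0 else 0) + (\<Sum>i = 1..<l. if p ! i = v then ?g i else 0)"
    using \<open>p \<noteq> []\<close> by (subst lessThan_atLeast0, subst sum.atLeast_Suc_lessThan[OF assms(2)])
      (simp add: hd_conv_nth)
  also have "(\<Sum>i<l. if p ! Suc i = v then ?g i else 0) =
      (\<Sum>i = 1..<l. if p ! i = v then ?g (i - 1) else 0) + (if last p = v then ?g (l - 1) else 0)"
    using assms(1) \<open>p \<noteq> []\<close> sum.shift_bounds_Suc_ivl[of "\<lambda>i. if p ! i = v then ?g (i - 1) else 0" 0 m]
    by (simp add: m last_conv_nth lessThan_atLeast0 cong: if_cong)
  finally show ?thesis
    by (auto simp: sum.distrib[symmetric] intro!: sum.cong)
qed

context
  fixes G :: "'a ugraph" and ps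
  assumes ps: "path_system G ps" and simple: "simple_graph G"
begin

lemma path_in_system:
  assumes "p \<in> set ps"
  shows "length p = Suc (length p - 1)" "0 < length p - 1" "p \<noteq> []"
    "\<And>i. i < length p - 1 \<Longrightarrow> p ! i \<noteq> p ! Suc i"
proof -
  have "2 \<le> length p"
    using ps assms by (auto simp: path_system_def)
  then show "length p = Suc (length p - 1)" "0 < length p - 1" "p \<noteq> []"
    by auto
  fix i assume "i < length p - 1"
  then have "{p ! i, p ! Suc i} \<in> set (walk_edges p)"
    by (auto simp: set_walk_edges)
  then have "{p ! i, p ! Suc i} \<in> edges G"
    using ps assms by (auto simp: path_system_def)
  then show "p ! i \<noteq> p ! Suc i"
    by (rule edge_card[OF simple])
qed

lemma inner_nth: "p \<in> set ps \<Longrightarrow> 0 < i \<Longrightarrow> i < length p - 1 \<Longrightarrow> p ! i \<in> set (inner_verts p)"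
  using nth_inner_verts[of "i - 1" p] by (auto simp: in_set_conv_nth intro!: exI[of _ "i - 1"])

lemma path_color_end:
  assumes "p \<in> set ps" "v \<notin> set (inner_verts p)"
  shows "path_color w p v = (if hd p = v then weight_at w p 0 else 0) +
    (if last p = v then weight_at w p (length p - 2) else 0)"
proof -
  have "(\<Sum>i = 1..<length p - 1. if p ! i = v then weight_at w p (i - 1) + weight_at w p i else 0) = 0"
    using inner_nth[OF assms(1)] assms(2) by (intro sum.neutral) auto
  then show ?thesis
    using path_color_eq[OF path_in_system(1,2,4)[OF assms(1)]] by (simp add: numeral_2_eq_2)
qed

lemma induced_color_inner:
  assumes "p \<in> set ps" "0 < i" "i < length p - 1"
  shows "induced_color G w (p ! i) = weight_at w p (i - 1) + weight_at w p i"
proof -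
  let ?v = "p ! i"
  obtain as bs where split: "ps = as @ p # bs"
    using assms(1) by (meson split_list)
  have v: "?v \<in> set (inner_verts p)"
    using inner_nth assms by blast
  have dist: "distinct (inner_verts p)" "?v \<noteq> hd p" "?v \<noteq> last p"
    using ps v unfolding path_system_def split by auto
  have "path_color w q ?v = 0" if "q \<in> set as \<union> set bs" for q
  proof -
    have "?v \<notin> set (inner_verts q)" "?v \<noteq> hd q" "?v \<noteq> last q"
      using ps v that unfolding path_system_def split by auto
    then show ?thesis
      using path_color_end[of q ?v w] that split by auto
  qed
  then have "(\<Sum>q\<leftarrow>as. path_color w q ?v) = 0" "(\<Sum>q\<leftarrow>bs. path_color w q ?v) = 0"
    by (simp_all add: sum_list_eq_0_iff)
  then have "induced_color G w ?v = path_color w p ?v"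
    unfolding induced_color_path_color[OF ps] by (simp add: split)
  also have "\<dots> = (\<Sum>j = 1..<length p - 1. if p ! j = ?v
      then weight_at w p (j - 1) + weight_at w p j else 0)"
    using path_color_eq[OF path_in_system(1,2,4)[OF assms(1)]] dist by simp
  also have "\<dots> = (\<Sum>j = 1..<length p - 1. if j = i
      then weight_at w p (j - 1) + weight_at w p j else 0)"
  proof (rule sum.cong)
    fix j assume "j \<in> {1..<length p - 1}"
    then have "0 < j" "j - 1 < length p - 2" "i - 1 < length p - 2"
      using assms by auto
    then have "p ! j = ?v \<longleftrightarrow> j = i"
      using nth_eq_iff_index_eq[OF dist(1), of "j - 1" "i - 1"] \<open>0 < i\<close>
        nth_inner_verts[of "j - 1" p] nth_inner_verts[of "i - 1" p] by auto
    then show "(if p ! j = ?v then weight_at w p (j - 1) + weight_at w p j else 0) =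
        (if j = i then weight_at w p (j - 1) + weight_at w p j else 0)"
      by simp
  qed simp
  also have "\<dots> = weight_at w p (i - 1) + weight_at w p i"
    using assms by simp
  finally show ?thesis .
qed

lemma vc_edge_weighting_proper_along:
  "vc_edge_weighting G k w \<longleftrightarrow> (\<forall>p\<in>set ps. proper_along k (length p - 1) (weight_at w p)
     (induced_color G w (hd p)) (induced_color G w (last p)))"
proof -
  let ?C = "induced_color G w"
  have E: "edges G = (\<Union>p\<in>set ps. {{p ! i, p ! Suc i} | i. i < length p - 1})"
    using ps by (auto simp: path_system_def set_walk_edges less_diff_conv)
  have along: "proper_along k (length p - 1) (weight_at w p) (?C (hd p)) (?C (last p)) \<longleftrightarrow>
      (\<forall>i<length p - 1. weight_at w p i \<in> {1..k}) \<and>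
      (\<forall>i<length p - 1. ?C (p ! i) \<noteq> ?C (p ! Suc i))" if "p \<in> set ps" for p
    using proper_along_colors[of "length p - 1" "\<lambda>i. ?C (p ! i)" "weight_at w p" k]
      induced_color_inner[OF that] path_in_system[OF that]
    by (simp add: hd_conv_nth last_conv_nth)
  have weights: "(\<forall>e\<in>edges G. w e \<in> {1..k}) \<longleftrightarrow>
      (\<forall>p\<in>set ps. \<forall>i<length p - 1. weight_at w p i \<in> {1..k})"
    unfolding E weight_at_def by auto
  have colors: "(\<forall>u v. {u, v} \<in> edges G \<longrightarrow> ?C u \<noteq> ?C v) \<longleftrightarrow>
      (\<forall>p\<in>set ps. \<forall>i<length p - 1. ?C (p ! i) \<noteq> ?C (p ! Suc i))"
  proof (intro iffI ballI allI impI)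
    fix p i assume "\<forall>u v. {u, v} \<in> edges G \<longrightarrow> ?C u \<noteq> ?C v" "p \<in> set ps" "i < length p - 1"
    then show "?C (p ! i) \<noteq> ?C (p ! Suc i)"
      unfolding E by blast
  next
    fix u v assume *: "\<forall>p\<in>set ps. \<forall>i<length p - 1. ?C (p ! i) \<noteq> ?C (p ! Suc i)"
      and "{u, v} \<in> edges G"
    then obtain p i where "p \<in> set ps" "i < length p - 1" "{u, v} = {p ! i, p ! Suc i}"
      unfolding E by blast
    then show "?C u \<noteq> ?C v"
      using * by (metis doubleton_eq_iff)
  qed
  show ?thesis
    unfolding vc_edge_weighting_def weights colors using along by auto
qed

end

text \<open>The colour of a corner, computed from the end weights \<open>es\<close> alone. A path contributes at both ends,
  which for a closed path are the same corner.\<close>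

definition corner_color :: "('a \<times> 'a \<times> nat) list \<Rightarrow> (nat \<times> nat) list \<Rightarrow> 'a \<Rightarrow> nat" where
  "corner_color sk es v =
     (\<Sum>((i, j, l), (x, y))\<leftarrow>zip sk es. (if i = v then x else 0) + (if j = v then y else 0))"

lemma assign_values:
  assumes "distinct (concat xss)" "list_all2 (\<lambda>xs ys. length xs = length ys) xss yss"
  shows "\<exists>w. map (map w) xss = yss"
  using assms(2,1)
proof (induction rule: list_all2_induct)
  case (Cons xs xss ys yss)
  then obtain w where w: "map (map w) xss = yss" by auto
  have "map (the \<circ> map_of (zip xs ys)) xs = ys"
    using Cons by (intro nth_equalityI) (auto simp: map_of_zip_nth)
  moreover have "map (\<lambda>x. if x \<in> set xs then f x else w x) zs = map w zs"
    if "zs \<in> set xss" for zs and f :: "'a \<Rightarrow> 'b"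
    using that Cons.prems by (intro map_cong) auto
  ultimately show ?case
    using w by (intro exI[of _ "\<lambda>x. if x \<in> set xs then (the \<circ> map_of (zip xs ys)) x else w x"])
      (simp cong: map_cong)
qed simp

definition weightable :: "'a ugraph \<Rightarrow> nat \<Rightarrow> bool" where
  "weightable G k \<longleftrightarrow> (\<exists>w. vc_edge_weighting G k w)"

text \<open>A weighting of the graph is the same as an independent choice of weights on every path, because
  the paths have no edge in common; the paths influence each other only through the corner
  colours.\<close>

lemma weightable_iff_links:
  assumes "subdivision G sk" "simple_graph G"
  shows "weightable G k \<longleftrightarrow> (\<exists>es. list_all2 (\<lambda>(i, j, l) (x, y).
     link k l x y (corner_color sk es i) (corner_color sk es j)) sk es)"
proof -
  obtain ps where ps: "path_system G ps" and sk: "list_all2 traces sk ps"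
    using assms(1) by (auto simp: subdivision_def)
  note simple = assms(2)
  define ends where
    "ends w = map (\<lambda>p. (weight_at w p 0, weight_at w p (length p - 2))) ps" for w
  have color: "induced_color G w v = corner_color sk (ends w) v"
    if "v \<notin> set (concat (map inner_verts ps))" for w v
  proof -
    have "(\<Sum>p\<leftarrow>ps. path_color w p v) = (\<Sum>p\<leftarrow>ps. (if hd p = v then weight_at w p 0 else 0) +
      (if last p = v then weight_at w p (length p - 2) else 0))"
      using path_color_end[OF ps simple] that by (intro arg_cong[of _ _ sum_list] map_cong) auto
    also have "\<dots> = corner_color sk (ends w) v"
      using sk unfolding ends_def corner_color_def
      by (induction rule: list_all2_induct) (auto simp: traces_def)
    finally show ?thesis
      unfolding induced_color_path_color[OF ps] .
  qed
  have colors: "induced_color G w (hd (ps ! n)) = corner_color sk (ends w) (hd (ps ! n))"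
    "induced_color G w (last (ps ! n)) = corner_color sk (ends w) (last (ps ! n))"
    if "n < length ps" for n w
    using ps that unfolding path_system_def
    by (intro color; auto simp del: set_concat dest!: nth_mem)+
  have len: "length sk = length ps"
    using sk by (rule list_all2_lengthD)
  have nth: "\<exists>l. sk ! n = (hd (ps ! n), last (ps ! n), l) \<and> length (ps ! n) = Suc l \<and> 0 < l"
    if "n < length ps" for n
    using sk that path_in_system(2)[OF ps simple, of "ps ! n"]
    by (cases "sk ! n") (auto simp: list_all2_conv_all_nth traces_def)
  show ?thesis
  proof
    assume "weightable G k"
    then obtain w where w: "vc_edge_weighting G k w"
      by (auto simp: weightable_def)
    have "list_all2 (\<lambda>(i, j, l) (x, y).
       link k l x y (corner_color sk (ends w) i) (corner_color sk (ends w) j)) sk (ends w)"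
    proof (rule list_all2_all_nthI)
      fix n assume "n < length sk"
      then have n: "n < length ps" by (simp add: len)
      then show "(\<lambda>(i, j, l) (x, y). link k l x y (corner_color sk (ends w) i)
          (corner_color sk (ends w) j)) (sk ! n) (ends w ! n)"
        using nth[OF n] w colors[OF n, of w] nth_mem[OF n]
        unfolding vc_edge_weighting_proper_along[OF ps simple] link_def
        by (fastforce simp: ends_def numeral_2_eq_2)
    qed (simp add: ends_def len)
    then show "\<exists>es. list_all2 (\<lambda>(i, j, l) (x, y).
       link k l x y (corner_color sk es i) (corner_color sk es j)) sk es"
      by (rule exI)
  next
    assume "\<exists>es. list_all2 (\<lambda>(i, j, l) (x, y).
       link k l x y (corner_color sk es i) (corner_color sk es j)) sk es"
    then obtain es where es: "list_all2 (\<lambda>(i, j, l) (x, y).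
       link k l x y (corner_color sk es i) (corner_color sk es j)) sk es"
      by (elim exE)
    have "\<forall>n<length ps. \<exists>g. proper_along k (length (ps ! n) - 1) g
        (corner_color sk es (hd (ps ! n))) (corner_color sk es (last (ps ! n))) \<and>
        es ! n = (g 0, g (length (ps ! n) - 2))"
    proof (intro allI impI)
      fix n assume n: "n < length ps"
      obtain l where l: "sk ! n = (hd (ps ! n), last (ps ! n), l)" "length (ps ! n) = Suc l"
        using nth[OF n] by blast
      have "(\<lambda>(i, j, l) (x, y). link k l x y (corner_color sk es i) (corner_color sk es j))
          (sk ! n) (es ! n)"
        using list_all2_nthD[OF es] n len by simp
      then show "\<exists>g. proper_along k (length (ps ! n) - 1) g
        (corner_color sk es (hd (ps ! n))) (corner_color sk es (last (ps ! n))) \<and>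
        es ! n = (g 0, g (length (ps ! n) - 2))"
        using l by (cases "es ! n") (auto simp: link_def numeral_2_eq_2)
    qed
    then obtain g where g: "\<And>n. n < length ps \<Longrightarrow> proper_along k (length (ps ! n) - 1) (g n)
        (corner_color sk es (hd (ps ! n))) (corner_color sk es (last (ps ! n)))"
      and es_g: "\<And>n. n < length ps \<Longrightarrow> es ! n = (g n 0, g n (length (ps ! n) - 2))"
      by metis
    define yss where "yss = map (\<lambda>n. map (g n) [0..<length (ps ! n) - 1]) [0..<length ps]"
    have "list_all2 (\<lambda>xs ys. length xs = length ys) (map walk_edges ps) yss"
      by (auto simp: list_all2_conv_all_nth yss_def)
    then obtain w where w: "map (map w) (map walk_edges ps) = yss"
      using assign_values ps unfolding path_system_def by blast
    have wg: "weight_at w (ps ! n) i = g n i" if "n < length ps" "i < length (ps ! n) - 1" for n i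
    proof -
      have "map (map w) (map walk_edges ps) ! n ! i = yss ! n ! i"
        by (simp only: w)
      then show ?thesis
        using that by (simp add: yss_def weight_at_def nth_walk_edges)
    qed
    have pos: "0 < length (ps ! n) - 1" if "n < length ps" for n
      using path_in_system(2)[OF ps simple] that by simp
    have "es = ends w"
    proof (rule nth_equalityI)
      fix n assume "n < length es"
      then have n: "n < length ps"
        using list_all2_lengthD[OF es] len by simp
      have "weight_at w (ps ! n) 0 = g n 0"
        "weight_at w (ps ! n) (length (ps ! n) - 2) = g n (length (ps ! n) - 2)"
        using pos[OF n] by (intro wg[OF n]; simp)+
      then show "es ! n = ends w ! n"
        using n es_g[OF n] by (simp add: ends_def)
    qed (use list_all2_lengthD[OF es] len in \<open>simp add: ends_def\<close>)
    have "proper_along k (length (ps ! n) - 1) (weight_at w (ps ! n))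
        (induced_color G w (hd (ps ! n))) (induced_color G w (last (ps ! n)))"
      if n: "n < length ps" for n
      using g[OF n] wg[OF n] colors[OF n, of w] pos[OF n] \<open>es = ends w\<close>
      by (auto simp: proper_along_def)
    then have "vc_edge_weighting G k w"
      unfolding vc_edge_weighting_proper_along[OF ps simple] by (auto simp: in_set_conv_nth)
    then show "weightable G k"
      by (auto simp: weightable_def)
  qed
qed

section \<open>Weighting a single path\<close>

lemma link_weights: "link k l x y S T \<Longrightarrow> 0 < l \<Longrightarrow> x \<in> {1..k} \<and> y \<in> {1..k}"
  by (auto simp: link_def proper_along_def)

lemma link_mono: "link k l x y S T \<Longrightarrow> k \<le> k' \<Longrightarrow> link k' l x y S T"
proof -
  assume "link k l x y S T" and k: "k \<le> k'"
  then obtain g where g: "proper_along k l g S T" "g 0 = x" "g (l - 1) = y"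
    by (auto simp: link_def)
  have "{1..k} \<subseteq> {1..k'}" using k by simp
  then have "proper_along k' l g S T"
    using g(1) unfolding proper_along_def by blast
  then show "link k' l x y S T"
    using g by (auto simp: link_def)
qed

lemma link_1_iff: "link k 1 x y S T \<longleftrightarrow> x = y \<and> x \<in> {1..k} \<and> S \<noteq> T"
  by (auto simp: link_def proper_along_def)

text \<open>With a single weight all inner vertices have colour 2, so there is at most one of them.\<close>

lemma link_weight_1_iff:
  assumes "0 < l"
  shows "link 1 l x y S T \<longleftrightarrow> x = 1 \<and> y = 1 \<and> (l = 1 \<and> S \<noteq> T \<or> l = 2 \<and> S \<noteq> 2 \<and> T \<noteq> 2)"
proof
  assume "link 1 l x y S T"
  then obtain g where g: "proper_along 1 l g S T" "g 0 = x" "g (l - 1) = y"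
    by (auto simp: link_def)
  then have one: "g i = 1" if "i < l" for i
    using that by (auto simp: proper_along_def)
  have "\<not> 2 < l"
  proof
    assume "2 < l"
    moreover have "\<forall>i. i + 2 < l \<longrightarrow> g i \<noteq> g (i + 2)"
      using g(1) unfolding proper_along_def by blast
    ultimately show False
      using one[of 0] one[of 2] by (metis add_0 zero_less_numeral less_trans)
  qed
  then have "l = 1 \<or> l = 2"
    using assms by linarith
  then show "x = 1 \<and> y = 1 \<and> (l = 1 \<and> S \<noteq> T \<or> l = 2 \<and> S \<noteq> 2 \<and> T \<noteq> 2)"
    using g one[of 0] one[of 1] by (auto simp: proper_along_def)
next
  assume "x = 1 \<and> y = 1 \<and> (l = 1 \<and> S \<noteq> T \<or> l = 2 \<and> S \<noteq> 2 \<and> T \<noteq> 2)"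
  then show "link 1 l x y S T"
    by (auto simp: link_def proper_along_def intro!: exI[of _ "\<lambda>_. 1"])
qed

text \<open>Variants for the simplifier, which rewrites 1 to the successor of 0.\<close>

lemmas link_weight_1 = link_weight_1_iff[unfolded One_nat_def]
lemmas link_1 = link_1_iff[unfolded One_nat_def]

lemma proper_along_2_alternates:
  assumes "proper_along 2 l g S T" "i + 2 * m < l"
  shows "g (i + 2 * m) = (if even m then g i else 3 - g i)"
  using assms(2)
proof (induction m)
  case (Suc m)
  have "g (i + 2 * m) \<noteq> g (i + 2 * m + 2)" "g (i + 2 * m) \<in> {1..2}" "g (i + 2 * m + 2) \<in> {1..2}"
    "g i \<in> {1..2}"
    using assms(1) Suc.prems by (auto simp: proper_along_def)
  then show ?case
    using Suc by (auto split: if_splits)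
qed simp

text \<open>In a path of odd length the first and the last edge have the same parity of position, and the
  weights in these positions alternate.\<close>

lemma link_2_ends:
  assumes "link 2 l x y S T"
  shows "l mod 4 = 1 \<Longrightarrow> x = y" "l mod 4 = 3 \<Longrightarrow> x + y = 3"
proof -
  obtain g where g: "proper_along 2 l g S T" "g 0 = x" "g (l - 1) = y"
    using assms by (auto simp: link_def)
  show "x = y" if "l mod 4 = 1"
  proof -
    define m where "m = l div 4"
    have "l = 4 * m + 1" using that unfolding m_def by presburger
    then show ?thesis
      using proper_along_2_alternates[OF g(1), of 0 "2 * m"] g by simp
  qed
  show "x + y = 3" if "l mod 4 = 3"
  proof -
    define m where "m = l div 4"
    have l: "l = 4 * m + 3" using that unfolding m_def by presburger
    have "g (0 + 2 * (2 * m + 1)) = 3 - g 0"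
      using proper_along_2_alternates[OF g(1), of 0 "2 * m + 1"] l by simp
    moreover have "l - 1 = 0 + 2 * (2 * m + 1)"
      using l by simp
    ultimately have "y = 3 - x"
      using g by simp
    moreover have "x \<in> {1..2}"
      using link_weights[OF assms] l by simp
    ultimately show ?thesis by auto
  qed
qed

text \<open>The last weight equals the second one. The base point and the vertex after it then have the same
  colour: both add the first weight to that value.\<close>

lemma no_closed_link_2:
  assumes "n mod 4 = 2" "n \<noteq> 2"
  shows "\<not> link 2 n x y (x + y) (x + y)"
proof
  assume "link 2 n x y (x + y) (x + y)"
  then obtain g where g: "proper_along 2 n g (x + y) (x + y)" "g 0 = x" "g (n - 1) = y"
    by (auto simp: link_def)
  define m where "m = n div 4"
  have n: "n = 4 * m + 2" using assms unfolding m_def by presburger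
  have "y = g 1"
    using proper_along_2_alternates[OF g(1), of 1 "2 * m"] g by (simp add: n add.commute)
  then show False
    using g by (simp add: proper_along_def n)
qed

text \<open>The solution of \<open>w\<^sub>i\<^sub>+\<^sub>2 = 3 - w\<^sub>i\<close> that starts with \<open>p\<close> and \<open>q\<close>; it has period 4.\<close>

definition alternating :: "nat \<Rightarrow> nat \<Rightarrow> nat \<Rightarrow> nat" where
  "alternating p q i = [p, q, 3 - p, 3 - q] ! (i mod 4)"

lemma alternating_mod:
  "i mod 4 = 0 \<Longrightarrow> alternating p q i = p" "i mod 4 = 1 \<Longrightarrow> alternating p q i = q"
  "i mod 4 = 2 \<Longrightarrow> alternating p q i = 3 - p" "i mod 4 = 3 \<Longrightarrow> alternating p q i = 3 - q"
  by (simp_all add: alternating_def)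

lemma alternating_step:
  assumes "p \<in> {1, 2}" "q \<in> {1, 2}"
  shows "alternating p q i \<in> {1..2}" "alternating p q i \<noteq> alternating p q (i + 2)"
proof -
  consider "i mod 4 = 0" "(i + 2) mod 4 = 2" | "i mod 4 = 1" "(i + 2) mod 4 = 3"
    | "i mod 4 = 2" "(i + 2) mod 4 = 0" | "i mod 4 = 3" "(i + 2) mod 4 = 1"
    by atomize_elim presburger
  then show "alternating p q i \<in> {1..2}" "alternating p q i \<noteq> alternating p q (i + 2)"
    using assms by (cases; auto simp: alternating_mod simp del: add_2_eq_Suc')+
qed

lemma link_alternating:
  assumes "p \<in> {1, 2}" "q \<in> {1, 2}" "2 \<le> l"
    and "S \<noteq> p + q" "T \<noteq> alternating p q (l - 2) + alternating p q (l - 1)"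
  shows "link 2 l p (alternating p q (l - 1)) S T"
proof -
  have "\<forall>i. i + 2 < l \<longrightarrow> alternating p q i \<noteq> alternating p q (i + 2)"
    using alternating_step(2)[OF assms(1,2)] by blast
  then have "proper_along 2 l (alternating p q) S T"
    using alternating_step(1)[OF assms(1,2)] assms(3-5)
    by (simp only: proper_along_def) (simp add: alternating_mod)
  then show ?thesis
    by (auto simp: link_def alternating_mod intro!: exI[of _ "alternating p q"])
qed

lemma pred_mod_4:
  fixes l :: nat
  shows "l mod 4 = 0 \<Longrightarrow> 0 < l \<Longrightarrow> (l - 2) mod 4 = 2 \<and> (l - 1) mod 4 = 3"
    and "l mod 4 = 1 \<Longrightarrow> l \<noteq> 1 \<Longrightarrow> (l - 2) mod 4 = 3 \<and> (l - 1) mod 4 = 0"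
    and "l mod 4 = 2 \<Longrightarrow> (l - 2) mod 4 = 0 \<and> (l - 1) mod 4 = 1"
    and "l mod 4 = 3 \<Longrightarrow> (l - 2) mod 4 = 1 \<and> (l - 1) mod 4 = 2"
proof -
  define k where "k = l div 4"
  have l: "l = 4 * k + l mod 4" by (simp add: k_def)
  have red: "i = r + 4 * j \<Longrightarrow> i mod 4 = r mod 4" for i r j :: nat
    by simp
  show "l mod 4 = 2 \<Longrightarrow> (l - 2) mod 4 = 0 \<and> (l - 1) mod 4 = 1"
    using l red[of "l - 2" 0 k] red[of "l - 1" 1 k] by simp
  show "l mod 4 = 3 \<Longrightarrow> (l - 2) mod 4 = 1 \<and> (l - 1) mod 4 = 2"
    using l red[of "l - 2" 1 k] red[of "l - 1" 2 k] by simp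
  show "(l - 2) mod 4 = 2 \<and> (l - 1) mod 4 = 3" if "l mod 4 = 0" "0 < l"
  proof -
    have "k \<noteq> 0" using l that by linarith
    then obtain j where "k = Suc j" by (cases k) auto
    then show ?thesis
      using l that red[of "l - 2" 2 j] red[of "l - 1" 3 j] by simp
  qed
  show "(l - 2) mod 4 = 3 \<and> (l - 1) mod 4 = 0" if "l mod 4 = 1" "l \<noteq> 1"
  proof -
    have "k \<noteq> 0" using l that by linarith
    then obtain j where "k = Suc j" by (cases k) auto
    then show ?thesis
      using l that red[of "l - 2" 3 j] red[of "l - 1" 0 "Suc j"] by simp
  qed
qed

text \<open>In a path of even length the second weight is tied to the last one and the last but one to the
  first. This leaves no freedom besides the end weights; colours \<open>x + 3\<close> and \<open>y + 3\<close> are large enough to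
  differ from those of the neighbours in any case.\<close>

lemma link_even:
  assumes "even l" "0 < l" "x \<in> {1, 2}" "y \<in> {1, 2}" "x + 3 \<le> S" "y + 3 \<le> T"
  shows "link 2 l x y S T"
proof -
  have "l mod 4 = 0 \<or> l mod 4 = 2" "2 \<le> l"
    using assms(1,2) by presburger+
  then consider "(l - 2) mod 4 = 0" "(l - 1) mod 4 = 1" | "(l - 2) mod 4 = 2" "(l - 1) mod 4 = 3"
    using pred_mod_4(1,3)[of l] assms(2) by (elim disjE) simp_all
  then show ?thesis
  proof cases
    case 1
    then show ?thesis
      using link_alternating[of x y l S T] assms by (auto simp: alternating_mod)
  next
    case 2
    then show ?thesis
      using link_alternating[of x "3 - y" l S T] assms by (auto simp: alternating_mod)
  qed
qed

text \<open>The second and the last but one weight coincide and can be chosen freely. The choice 1 makes both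
  neighbours of the ends as small as possible.\<close>

lemma link_3_mod_4:
  assumes "l mod 4 = 3" "x \<in> {1, 2}" "y = 3 - x" "x + 2 \<le> S" "y + 2 \<le> T"
  shows "link 2 l x y S T"
proof -
  have "2 \<le> l"
    using assms(1) by presburger
  have "(l - 2) mod 4 = 1" "(l - 1) mod 4 = 2"
    using pred_mod_4(4)[OF assms(1)] by blast+
  then show ?thesis
    using link_alternating[of x 1 l S T] assms \<open>2 \<le> l\<close> by (auto simp: alternating_mod)
qed

text \<open>The second and the last but one weight are 1 and 2 in some order. The 2 is put next to the end
  whose colour is large enough.\<close>

lemma link_1_mod_4_long:
  assumes "l mod 4 = 1" "l \<noteq> 1" "x \<in> {1, 2}" "x + 2 \<le> S" "x + 2 \<le> T" "x + 3 \<le> S \<or> x + 3 \<le> T"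
  shows "link 2 l x x S T"
proof -
  have "2 \<le> l"
    using assms(1,2) by presburger
  have "(l - 2) mod 4 = 3" "(l - 1) mod 4 = 0"
    using pred_mod_4(2)[OF assms(1,2)] by blast+
  then show ?thesis
    using link_alternating[of x 1 l S T] link_alternating[of x 2 l S T] assms \<open>2 \<le> l\<close>
    by (auto simp: alternating_mod)
qed

text \<open>A uniform sufficient condition that includes single edges: if the colours are different, one of
  them is large enough for \<open>link_1_mod_4_long\<close>.\<close>

lemma link_1_mod_4:
  assumes "l mod 4 = 1" "x \<in> {1, 2}" "x + 2 \<le> S" "x + 2 \<le> T" "S \<noteq> T"
  shows "link 2 l x x S T"
proof (cases "l = 1")
  case True
  then show ?thesis using assms link_1_iff[of 2 x x S T] by auto
next
  case False
  then show ?thesis using assms by (intro link_1_mod_4_long) auto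
qed

lemma link_not_1_mod_4:
  assumes "n mod 4 \<noteq> 1" "0 < n" "{x, y} = {1, 2}" "x + 3 \<le> S" "y + 3 \<le> T"
  shows "link 2 n x y S T"
proof -
  have xy: "x \<in> {1, 2}" "y \<in> {1, 2}" "y = 3 - x"
    using assms(3) by (auto simp: doubleton_eq_iff)
  have "even n \<or> n mod 4 = 3"
    using assms(1) by presburger
  then show ?thesis
  proof
    assume "even n"
    then show ?thesis
      using assms xy by (intro link_even) auto
  next
    assume "n mod 4 = 3"
    then show ?thesis
      using assms xy by (intro link_3_mod_4) auto
  qed
qed

text \<open>A third weight lets a path of length 1 modulo 4 have different end weights: only the last weight
  of an alternating sequence is changed to 3.\<close>

lemma link_3_weights:
  assumes "l mod 4 = 1" "l \<noteq> 1" "4 \<le> S" "6 \<le> T"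
  shows "link 3 l 2 3 S T"
proof -
  let ?g = "\<lambda>i. if i = l - 1 then 3 else alternating 2 1 i"
  have "5 \<le> l"
    using assms(1,2) by presburger
  then have l: "(l - 2) mod 4 = 3" "5 \<le> l"
    using pred_mod_4(2)[OF assms(1,2)] by simp_all
  have alt: "alternating 2 1 i \<in> {1..2}" "alternating 2 1 i \<noteq> alternating 2 1 (i + 2)" for i
    using alternating_step[of 2 1 i] by simp_all
  have range: "?g i \<in> {1..3}" for i
    using alt(1)[of i] by auto
  have step: "?g i \<noteq> ?g (i + 2)" if "i + 2 < l" for i
    using alt(1)[of i] alt(2)[of i] that by auto
  have g: "?g 0 = 2" "?g 1 = 1" "?g (l - 2) = 2" "?g (l - 1) = 3"
    using l by (auto simp: alternating_mod)
  have "proper_along 3 l ?g S T"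
    unfolding proper_along_def g using range step assms by auto
  then show ?thesis
    using l by (auto simp: link_def alternating_mod intro!: exI[of _ ?g])
qed

lemma closed_link_2:
  assumes "n mod 4 = 0" "0 < n"
  shows "link 2 n 1 2 3 3"
proof -
  have "2 \<le> n"
    using assms by presburger
  have "(n - 2) mod 4 = 2" "(n - 1) mod 4 = 3"
    using pred_mod_4(1)[OF assms] by blast+
  then show ?thesis
    using link_alternating[of 1 1 n 3 3] \<open>2 \<le> n\<close> by (simp add: alternating_mod)
qed

text \<open>The even and the odd positions on a cycle of length 2 modulo 4 form two cyclic sequences of odd
  length in which neighbours must differ. The last element of each gets the third weight.\<close>

lemma closed_link_3:
  assumes "n mod 4 = 2" "n \<noteq> 2"
  shows "link 3 n 1 3 4 4"
proof -
  let ?g = "\<lambda>i. if n - 2 \<le> i then 3 else alternating 1 1 i"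
  have n: "6 \<le> n" using assms by presburger
  have alt: "alternating 1 1 i \<in> {1..2}" "alternating 1 1 i \<noteq> alternating 1 1 (i + 2)" for i
    using alternating_step[of 1 1 i] by simp_all
  have range: "?g i \<in> {1..3}" for i
    using alt(1)[of i] by auto
  have step: "?g i \<noteq> ?g (i + 2)" if "i + 2 < n" for i
    using alt(1)[of i] alt(2)[of i] that by auto
  have g: "?g 0 = 1" "?g 1 = 1" "?g (n - 2) = 3" "?g (n - 1) = 3"
    using n by (auto simp: alternating_mod)
  have "proper_along 3 n ?g 4 4"
    unfolding proper_along_def g using range step n by auto
  then show ?thesis
    using n by (auto simp: link_def alternating_mod intro!: exI[of _ ?g])
qed

section \<open>Weighting two parallel paths\<close>

text \<open>Two paths with common ends, where \<open>P\<close> and \<open>Q\<close> are the sums of the other weights at these ends and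
  \<open>\<alpha>\<close> and \<open>\<beta>\<close> are the sums of the two end weights of the pair. The lemmas below tabulate possible
  values of \<open>(\<alpha>, \<beta>)\<close> by the lengths modulo 4.\<close>

definition bigon :: "nat \<Rightarrow> nat \<Rightarrow> nat \<Rightarrow> nat \<Rightarrow> nat \<Rightarrow> nat \<Rightarrow> nat \<Rightarrow> bool" where
  "bigon k l m P Q \<alpha> \<beta> \<longleftrightarrow> (\<exists>x y x' y'. \<alpha> = x + x' \<and> \<beta> = y + y' \<and>
     link k l x y (P + \<alpha>) (Q + \<beta>) \<and> link k m x' y' (P + \<alpha>) (Q + \<beta>))"

lemma bigonI:
  "link k l x y (P + \<alpha>) (Q + \<beta>) \<Longrightarrow> link k m x' y' (P + \<alpha>) (Q + \<beta>) \<Longrightarrow> \<alpha> = x + x' \<Longrightarrow>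
    \<beta> = y + y' \<Longrightarrow> bigon k l m P Q \<alpha> \<beta>"
  by (auto simp: bigon_def)

lemma bigon_commute: "bigon k l m P Q \<alpha> \<beta> \<Longrightarrow> bigon k m l P Q \<alpha> \<beta>"
proof -
  assume "bigon k l m P Q \<alpha> \<beta>"
  then obtain x y x' y' where "\<alpha> = x + x'" "\<beta> = y + y'"
    "link k l x y (P + \<alpha>) (Q + \<beta>)" "link k m x' y' (P + \<alpha>) (Q + \<beta>)"
    unfolding bigon_def by blast
  then show "bigon k m l P Q \<alpha> \<beta>"
    by (intro bigonI[of k m x' y' P \<alpha> Q \<beta> l x y]) simp_all
qed

lemma bigon_mono: "bigon k l m P Q \<alpha> \<beta> \<Longrightarrow> k \<le> k' \<Longrightarrow> bigon k' l m P Q \<alpha> \<beta>"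
  unfolding bigon_def using link_mono by blast

lemma bigon_even:
  assumes "even l" "even m" "0 < l" "0 < m" "0 < P" "0 < Q"
    and "\<alpha> = 4 \<or> \<alpha> = 3 \<and> 2 \<le> P" "\<beta> = 4 \<or> \<beta> = 3 \<and> 2 \<le> Q"
  shows "bigon 2 l m P Q \<alpha> \<beta>"
  by (rule bigonI[of _ _ 2 2 _ _ _ _ _ "\<alpha> - 2" "\<beta> - 2"]; (rule link_even)?) (use assms in auto)

text \<open>Paths of length 1 modulo 4 contribute the same amount at both ends, so the colours of the ends
  differ, as a single edge needs, exactly if \<open>P\<close> and \<open>Q\<close> do.\<close>

lemma bigon_1_1:
  assumes "l mod 4 = 1" "m mod 4 = 1" "0 < P" "0 < Q" "P \<noteq> Q" "t \<in> {2, 3, 4}"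
  shows "bigon 2 l m P Q t t"
proof -
  have *: "bigon 2 l m P Q t t" if "t = x + y" "x \<in> {1, 2}" "y \<in> {1, 2}" for x y
    by (rule bigonI[of _ _ x x _ _ _ _ _ y y]; (rule link_1_mod_4)?) (use assms that in auto)
  have "t = 1 + 1 \<or> t = 2 + 1 \<or> t = 2 + 2"
    using assms(6) by auto
  then show ?thesis
    using *[of 1 1] *[of 2 1] *[of 2 2] by (elim disjE) simp_all
qed

text \<open>Without a single edge the ends may have the same colour.\<close>

lemma bigon_1_1_long:
  assumes "l mod 4 = 1" "m mod 4 = 1" "l \<noteq> 1" "m \<noteq> 1" "0 < P" "0 < Q"
  shows "bigon 2 l m P Q 4 4" and "2 \<le> P \<Longrightarrow> bigon 2 l m P Q 3 3"
proof -
  show "bigon 2 l m P Q 4 4"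
    by (rule bigonI[of _ _ 2 2 _ _ _ _ _ 2 2]; (rule link_1_mod_4_long)?) (use assms in auto)
  show "bigon 2 l m P Q 3 3" if "2 \<le> P"
    by (rule bigonI[of _ _ 2 2 _ _ _ _ _ 1 1]; (rule link_1_mod_4_long)?) (use assms that in auto)
qed

text \<open>The path of length 3 modulo 4 contributes a surplus of 1 at one end. The condition on \<open>P\<close> and \<open>Q\<close>
  says that the colours of the ends differ, in case the other path is a single edge.\<close>

lemma bigon_1_3:
  assumes "l mod 4 = 1" "m mod 4 = 3" "0 < P" "0 < Q"
  shows "P \<noteq> Q + 1 \<Longrightarrow> bigon 2 l m P Q 3 4" and "Q \<noteq> P + 1 \<Longrightarrow> bigon 2 l m P Q 4 3"
proof -
  show "bigon 2 l m P Q 3 4" if "P \<noteq> Q + 1"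
    by (rule bigonI[of _ _ 2 2 _ _ _ _ _ 1 2]; (rule link_1_mod_4 link_3_mod_4)?)
      (use assms that in auto)
  show "bigon 2 l m P Q 4 3" if "Q \<noteq> P + 1"
    by (rule bigonI[of _ _ 2 2 _ _ _ _ _ 2 1]; (rule link_1_mod_4 link_3_mod_4)?)
      (use assms that in auto)
qed

lemma bigon_3_3:
  assumes "l mod 4 = 3" "m mod 4 = 3" "0 < P" "0 < Q"
  shows "bigon 2 l m P Q 3 3" "bigon 2 l m P Q 2 4" "bigon 2 l m P Q 4 2"
proof -
  show "bigon 2 l m P Q 3 3"
    by (rule bigonI[of _ _ 1 2 _ _ _ _ _ 2 1]; (rule link_3_mod_4)?) (use assms in auto)
  show "bigon 2 l m P Q 2 4"
    by (rule bigonI[of _ _ 1 2 _ _ _ _ _ 1 2]; (rule link_3_mod_4)?) (use assms in auto)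
  show "bigon 2 l m P Q 4 2"
    by (rule bigonI[of _ _ 2 1 _ _ _ _ _ 2 1]; (rule link_3_mod_4)?) (use assms in auto)
qed

lemma bigon_mixed:
  assumes "l mod 4 = 1 \<and> m mod 4 = 3 \<or> l mod 4 = 3 \<and> m mod 4 = 1" "0 < P" "0 < Q"
  shows "P \<noteq> Q + 1 \<Longrightarrow> bigon 2 l m P Q 3 4" and "Q \<noteq> P + 1 \<Longrightarrow> bigon 2 l m P Q 4 3"
  using assms bigon_1_3[of l m P Q] bigon_1_3[of m l P Q] bigon_commute by blast+

lemma same_parity_cases:
  fixes l m :: nat
  assumes "even l \<longleftrightarrow> even m"
  obtains (even) "even l" "even m" | (one) "l mod 4 = 1" "m mod 4 = 1"
    | (mixed) "l mod 4 = 1 \<and> m mod 4 = 3 \<or> l mod 4 = 3 \<and> m mod 4 = 1"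
    | (three) "l mod 4 = 3" "m mod 4 = 3"
proof -
  have "odd n \<Longrightarrow> n mod 4 = 1 \<or> n mod 4 = 3" for n :: nat
    by presburger
  then show thesis
    using assms that by blast
qed

text \<open>The contribution does not depend on \<open>P\<close> and \<open>Q\<close>. This decouples the two pairs at a corner of degree
  four, where each pair is part of the other's outer sum.\<close>

lemma bigon_outer_large:
  assumes "even l \<longleftrightarrow> even m" "0 < l" "0 < m"
  obtains \<alpha> \<beta> where "\<alpha> \<in> {3, 4}" "\<beta> \<in> {3, 4}"
    "\<forall>P Q. 3 \<le> P \<longrightarrow> Q \<in> {1, 2} \<longrightarrow> bigon 2 l m P Q \<alpha> \<beta>"
  using assms(1)
proof (cases rule: same_parity_cases)
  case even
  show thesis by (rule that[of 4 4]; (intro allI impI, rule bigon_even)?) (use assms even in auto)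
next
  case one
  show thesis by (rule that[of 4 4]; (intro allI impI, rule bigon_1_1)?) (use one in auto)
next
  case mixed
  show thesis by (rule that[of 4 3]; (intro allI impI, rule bigon_mixed)?) (use mixed in auto)
next
  case three
  show thesis by (rule that[of 3 3]; (intro allI impI, rule bigon_3_3)?) (use three in auto)
qed

text \<open>Unequal outer sums suit pairs of every kind, even if one of the two paths is an edge.\<close>

lemma bigon_outer_unequal:
  assumes "even l \<longleftrightarrow> even m" "0 < l" "0 < m" "{P, Q} = {1, 2}"
  obtains \<alpha> \<beta> where "\<alpha> \<in> {3, 4}" "\<beta> \<in> {3, 4}" "bigon 2 l m P Q \<alpha> \<beta>"
  using assms(1)
proof (cases rule: same_parity_cases)
  case even
  show thesis by (rule that[of 4 4]; (rule bigon_even)?) (use assms even in \<open>auto simp: doubleton_eq_iff\<close>)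
next
  case one
  show thesis by (rule that[of 4 4]; (rule bigon_1_1)?) (use assms one in \<open>auto simp: doubleton_eq_iff\<close>)
next
  case mixed
  show thesis
  proof (cases "P = 2")
    case True
    show thesis by (rule that[of 4 3]; (rule bigon_mixed)?)
      (use assms mixed True in \<open>auto simp: doubleton_eq_iff\<close>)
  next
    case False
    show thesis by (rule that[of 3 4]; (rule bigon_mixed)?)
      (use assms mixed False in \<open>auto simp: doubleton_eq_iff\<close>)
  qed
next
  case three
  show thesis by (rule that[of 3 3]; (rule bigon_3_3)?) (use assms three in \<open>auto simp: doubleton_eq_iff\<close>)
qed

text \<open>This and the next lemma produce different contributions, 4 and 3, at the first end, which
  distinguishes the colours of two corners that are joined by an edge.\<close>

lemma bigon_start_4:
  assumes "even l \<longleftrightarrow> even m" "0 < l" "0 < m"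
  obtains \<beta> where "\<beta> \<in> {2, 3, 4}" "bigon 2 l m 2 1 4 \<beta>"
  using assms(1)
proof (cases rule: same_parity_cases)
  case even
  show thesis by (rule that[of 4]; (rule bigon_even)?) (use assms even in auto)
next
  case one
  show thesis by (rule that[of 4]; (rule bigon_1_1)?) (use one in auto)
next
  case mixed
  show thesis by (rule that[of 3]; (rule bigon_mixed)?) (use mixed in auto)
next
  case three
  show thesis by (rule that[of 2]; (rule bigon_3_3)?) (use three in auto)
qed

lemma bigon_start_3:
  assumes "even l \<longleftrightarrow> even m" "0 < l" "0 < m"
    and "\<not> (l mod 4 = 1 \<and> m mod 4 = 1 \<and> (l = 1 \<or> m = 1))"
  obtains \<beta> where "\<beta> \<in> {2, 3, 4}" "bigon 2 l m 2 2 3 \<beta>"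
  using assms(1)
proof (cases rule: same_parity_cases)
  case even
  show thesis by (rule that[of 4]; (rule bigon_even)?) (use assms even in auto)
next
  case one
  show thesis by (rule that[of 3]; (rule bigon_1_1_long)?) (use assms(4) one in auto)
next
  case mixed
  show thesis by (rule that[of 4]; (rule bigon_mixed)?) (use mixed in auto)
next
  case three
  show thesis by (rule that[of 3]; (rule bigon_3_3)?) (use three in auto)
qed

section \<open>Cycles\<close>

context
  fixes G :: "'a ugraph"
  assumes simple: "simple_graph G"
begin

lemma weightable_cycle_iff:
  assumes "subdivision G [(u, u, n)]"
  shows "weightable G k \<longleftrightarrow> (\<exists>x y. link k n x y (x + y) (x + y))"
  unfolding weightable_iff_links[OF assms simple]
  by (auto simp: list_all2_Cons1 corner_color_def)

lemma cycle_not_weightable_1: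
  assumes "subdivision G [(u, u, n)]"
  shows "\<not> weightable G 1"
  using weightable_cycle_iff[OF assms] closed_path_length[OF assms simple]
  by (auto simp: link_weight_1)

lemma cycle_weightable_2:
  assumes "subdivision G [(u, u, n)]" "bipartite G" "n mod 4 \<noteq> 2"
  shows "weightable G 2"
proof -
  have "even n" "0 < n"
    using subdivision_parity[OF assms(1,2)] closed_path_length[OF assms(1) simple] by auto
  then have "n mod 4 = 0"
    using assms(3) by presburger
  then have "link 2 n 1 2 3 3"
    using \<open>0 < n\<close> by (rule closed_link_2)
  moreover have "3 = 1 + (2 :: nat)"
    by simp
  ultimately have "link 2 n 1 2 (1 + 2) (1 + 2)"
    by metis
  then show ?thesis
    unfolding weightable_cycle_iff[OF assms(1)] by blast
qed

text \<open>The even positions form a cyclic sequence of odd length, so that 1 and 2 cannot alternate in it.\<close>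

lemma cycle_exceptional:
  assumes "subdivision G [(u, u, n)]" "n mod 4 = 2"
  shows "\<not> weightable G 2" "weightable G 3"
proof -
  have "n \<noteq> 2"
    using closed_path_length[OF assms(1) simple] by simp
  then have "link 3 n 1 3 4 4"
    using closed_link_3[OF assms(2)] by blast
  moreover have "4 = 1 + (3 :: nat)"
    by simp
  ultimately have "link 3 n 1 3 (1 + 3) (1 + 3)"
    by metis
  then show "weightable G 3"
    unfolding weightable_cycle_iff[OF assms(1)] by blast
  show "\<not> weightable G 2"
    unfolding weightable_cycle_iff[OF assms(1)]
    using no_closed_link_2[OF assms(2) \<open>n \<noteq> 2\<close>] by blast
qed

section \<open>Three paths with common ends\<close>

lemma theta_weightableI:
  assumes "subdivision G [(u, v, l), (u, v, m), (u, v, n)]" "u \<noteq> v"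
    and "bigon k l m p q \<alpha> \<beta>" "link k n p q (p + \<alpha>) (q + \<beta>)"
  shows "weightable G k"
proof -
  obtain x y x' y' where "\<alpha> = x + x'" "\<beta> = y + y'"
    "link k l x y (p + \<alpha>) (q + \<beta>)" "link k m x' y' (p + \<alpha>) (q + \<beta>)"
    using assms(3) unfolding bigon_def by blast
  then show ?thesis
    unfolding weightable_iff_links[OF assms(1) simple] using assms(2,4)
    by (intro exI[of _ "[(x, y), (x', y'), (p, q)]"]) (simp add: corner_color_def ac_simps)
qed

lemma theta_weightableE:
  assumes "subdivision G [(u, v, l), (u, v, m), (u, v, n)]" "u \<noteq> v" "weightable G k"
  obtains x y x' y' x'' y'' where
    "link k l x y (x + x' + x'') (y + y' + y'')" "link k m x' y' (x + x' + x'') (y + y' + y'')"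
    "link k n x'' y'' (x + x' + x'') (y + y' + y'')"
proof -
  have "\<exists>x y x' y' x'' y''.
    link k l x y (x + x' + x'') (y + y' + y'') \<and> link k m x' y' (x + x' + x'') (y + y' + y'') \<and>
    link k n x'' y'' (x + x' + x'') (y + y' + y'')"
    using assms(2,3) unfolding weightable_iff_links[OF assms(1) simple]
    by (auto simp: list_all2_Cons1 corner_color_def ac_simps) blast
  then show thesis using that by blast
qed

lemma theta_parity:
  assumes "subdivision G [(u, v, l), (u, v, m), (u, v, n)]" "bipartite G"
  shows "even l \<longleftrightarrow> even n" "even m \<longleftrightarrow> even n"
  using subdivision_parity[OF assms] by auto

lemma theta_weightable_1_iff:
  assumes "subdivision G [(u, v, l), (u, v, m), (u, v, n)]" "u \<noteq> v"
  shows "weightable G 1 \<longleftrightarrow> l = 2 \<and> m = 2 \<and> n = 2"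
proof
  assume "weightable G 1"
  then show "l = 2 \<and> m = 2 \<and> n = 2"
    by (rule theta_weightableE[OF assms])
      (use subdivision_pos[OF assms(1)] in \<open>auto simp: link_weight_1\<close>)
next
  assume "l = 2 \<and> m = 2 \<and> n = 2"
  then have "bigon 1 l m 1 1 2 2" "link 1 n 1 1 (1 + 2) (1 + 2)"
    by (auto simp: link_weight_1 intro!: bigonI[of _ _ 1 1 _ _ _ _ _ 1 1])
  then show "weightable G 1"
    using theta_weightableI[OF assms] by blast
qed

text \<open>A path of length 3 modulo 4 has end weights 2 and 1. As outer sums of the other two paths they are
  unequal, which is what a single edge among these needs.\<close>

lemma theta_weightable_2_three:
  assumes "subdivision G [(u, v, l), (u, v, m), (u, v, n)]" "u \<noteq> v" "bipartite G" "n mod 4 = 3"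
  shows "weightable G 2"
proof -
  have par: "even l \<longleftrightarrow> even m" "0 < l" "0 < m"
    using theta_parity[OF assms(1,3)] subdivision_pos[OF assms(1)] by auto
  then obtain \<alpha> \<beta> where "\<alpha> \<in> {3, 4}" "\<beta> \<in> {3, 4}" "bigon 2 l m 2 1 \<alpha> \<beta>"
    using bigon_outer_unequal[of l m 2 1] by (auto simp: insert_commute)
  moreover from this have "link 2 n 2 1 (2 + \<alpha>) (1 + \<beta>)"
    using assms(4) by (intro link_3_mod_4) auto
  ultimately show ?thesis
    using theta_weightableI[OF assms(1,2)] by blast
qed

lemma theta_weightable_2:
  assumes sub: "subdivision G [(u, v, l), (u, v, m), (u, v, n)]" and "u \<noteq> v" "bipartite G"
  shows "weightable G 2 \<or> (\<exists>a g. a mod 4 = 1 \<and> g mod 4 = 1 \<and>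
    subdivision G [(u, v, a), (u, v, 1), (u, v, g)])"
proof -
  note par = theta_parity[OF assms(1,3)]
  have pos: "0 < l" "0 < m" "0 < n"
    using subdivision_pos[OF sub] by simp_all
  have sub': "subdivision G [(u, v, m), (u, v, n), (u, v, l)]"
    "subdivision G [(u, v, l), (u, v, n), (u, v, m)]"
    "subdivision G [(u, v, m), (u, v, l), (u, v, n)]"
    by (rule subdivision_mset[OF sub], simp)+
  consider "even n" | "n mod 4 = 3 \<or> m mod 4 = 3 \<or> l mod 4 = 3"
    | "l mod 4 = 1" "m mod 4 = 1" "n mod 4 = 1"
    using par by atomize_elim presburger
  then show ?thesis
  proof cases
    case 1
    then have "bigon 2 l m 2 2 4 4"
      using par pos by (intro bigon_even) auto
    moreover have "link 2 n 2 2 (2 + 4) (2 + 4)"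
      using 1 pos by (intro link_even) auto
    ultimately show ?thesis
      using theta_weightableI[OF assms(1,2)] by blast
  next
    case 2
    then show ?thesis
      using theta_weightable_2_three[OF sub assms(2,3)] theta_weightable_2_three[OF sub'(1) assms(2,3)]
        theta_weightable_2_three[OF sub'(2) assms(2,3)] by blast
  next
    case 3
    show ?thesis
    proof (cases "l = 1 \<or> m = 1 \<or> n = 1")
      case True
      then show ?thesis
        using sub sub' 3 by blast
    next
      case False
      then have "bigon 2 l m 2 2 4 4"
        using 3 by (intro bigon_1_1_long) auto
      moreover have "link 2 n 2 2 (2 + 4) (2 + 4)"
        using 3 False by (intro link_1_mod_4_long) auto
      ultimately show ?thesis
        using theta_weightableI[OF assms(1,2)] by blast
    qed
  qed
qed

text \<open>All three paths contribute equally at both ends, so the ends have the same colour although an edge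
  joins them. With a third weight, one long path gets the end weights 2 and 3.\<close>

lemma theta_exceptional:
  assumes sub: "subdivision G [(u, v, a), (u, v, 1), (u, v, g)]" and "u \<noteq> v"
    and "a mod 4 = 1" "g mod 4 = 1"
  shows "\<not> weightable G 2" "weightable G 3"
proof -
  show "\<not> weightable G 2"
  proof
    assume "weightable G 2"
    then show False
      by (rule theta_weightableE[OF assms(1,2)]) (use link_2_ends(1) assms link_1_iff in \<open>metis mod_less one_less_numeral_iff semiring_norm(76)\<close>)
  qed
  have "a \<noteq> 1"
    using no_parallel_edges[of G u v a 1] sub by auto
  have "link 3 a 2 3 (2 + 4) (2 + 5)"
    using assms \<open>a \<noteq> 1\<close> by (intro link_3_weights) auto
  moreover have "link 3 1 2 2 (2 + 4) (2 + 5)"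
    by (simp add: link_1)
  ultimately have "bigon 3 a 1 2 2 4 5"
    by (rule bigonI) auto
  moreover have "link 3 g 2 2 (2 + 4) (2 + 5)"
    using assms by (intro link_mono[OF link_1_mod_4]) auto
  ultimately show "weightable G 3"
    using theta_weightableI[OF assms(1,2)] by blast
qed

section \<open>Four paths with common ends\<close>

lemma theta4_weightableI:
  assumes "subdivision G [(u, v, a), (u, v, b), (u, v, c), (u, v, d)]" "u \<noteq> v"
    and "bigon k a b \<gamma> \<delta> \<alpha> \<beta>" "bigon k c d \<alpha> \<beta> \<gamma> \<delta>"
  shows "weightable G k"
proof -
  obtain x y x' y' where "\<alpha> = x + x'" "\<beta> = y + y'"
    "link k a x y (\<gamma> + \<alpha>) (\<delta> + \<beta>)" "link k b x' y' (\<gamma> + \<alpha>) (\<delta> + \<beta>)"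
    using assms(3) unfolding bigon_def by blast
  moreover obtain z w z' w' where "\<gamma> = z + z'" "\<delta> = w + w'"
    "link k c z w (\<alpha> + \<gamma>) (\<beta> + \<delta>)" "link k d z' w' (\<alpha> + \<gamma>) (\<beta> + \<delta>)"
    using assms(4) unfolding bigon_def by blast
  ultimately show ?thesis
    unfolding weightable_iff_links[OF assms(1) simple] using assms(2)
    by (intro exI[of _ "[(x, y), (x', y'), (z, w), (z', w')]"]) (simp add: corner_color_def ac_simps)
qed

lemma theta4_weightableE:
  assumes "subdivision G [(u, v, a), (u, v, b), (u, v, c), (u, v, d)]" "u \<noteq> v" "weightable G k"
  obtains x y x' y' z w z' w' S T where
    "S = x + x' + z + z'" "T = y + y' + w + w'"
    "link k a x y S T" "link k b x' y' S T" "link k c z w S T" "link k d z' w' S T"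
proof -
  have "\<exists>x y x' y' z w z' w'.
    link k a x y (x + x' + z + z') (y + y' + w + w') \<and>
    link k b x' y' (x + x' + z + z') (y + y' + w + w') \<and>
    link k c z w (x + x' + z + z') (y + y' + w + w') \<and>
    link k d z' w' (x + x' + z + z') (y + y' + w + w')"
    using assms(2,3) unfolding weightable_iff_links[OF assms(1) simple]
    by (auto simp: list_all2_Cons1 corner_color_def ac_simps) blast
  then show thesis using that by blast
qed

lemma theta4_weightable_1_iff:
  assumes "subdivision G [(u, v, a), (u, v, b), (u, v, c), (u, v, d)]" "u \<noteq> v"
  shows "weightable G 1 \<longleftrightarrow> a = 2 \<and> b = 2 \<and> c = 2 \<and> d = 2"
proof
  assume "weightable G 1"
  then show "a = 2 \<and> b = 2 \<and> c = 2 \<and> d = 2"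
    by (rule theta4_weightableE[OF assms])
      (use subdivision_pos[OF assms(1)] in \<open>auto simp: link_weight_1\<close>)
next
  assume "a = 2 \<and> b = 2 \<and> c = 2 \<and> d = 2"
  then have "bigon 1 a b 2 2 2 2" "bigon 1 c d 2 2 2 2"
    by (auto simp: link_weight_1 intro!: bigonI[of _ _ 1 1 _ _ _ _ _ 1 1])
  then show "weightable G 1"
    using theta4_weightableI[OF assms] by blast
qed

lemma theta4_parity:
  assumes "subdivision G [(u, v, a), (u, v, b), (u, v, c), (u, v, d)]" "bipartite G"
  shows "even a \<longleftrightarrow> even d" "even b \<longleftrightarrow> even d" "even c \<longleftrightarrow> even d"
  using subdivision_parity[OF assms] by auto

text \<open>If the path of length 3 modulo 4 is put last, then its pair can make unequal contributions to the
  first pair, and the table entries only have to be matched.\<close>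

lemma theta4_weightable_2_three:
  assumes "subdivision G [(u, v, a), (u, v, b), (u, v, c), (u, v, d)]" "u \<noteq> v" "bipartite G"
    and "d mod 4 = 3"
  shows "weightable G 2"
proof -
  note intro = theta4_weightableI[OF assms(1,2)]
  have "odd d" using assms(4) by presburger
  then have par: "even a \<longleftrightarrow> even b" "odd a" "odd c" "even c \<longleftrightarrow> even d"
    using theta4_parity[OF assms(1,3)] by auto
  then have cd: "c mod 4 = 1 \<and> d mod 4 = 3 \<or> c mod 4 = 3 \<and> d mod 4 = 1 \<or> c mod 4 = 3 \<and> d mod 4 = 3"
    using assms(4) by presburger
  show ?thesis
    using par(1)
  proof (cases rule: same_parity_cases)
    case even
    then show ?thesis using par by simp
  next
    case one
    have "bigon 2 a b 3 4 4 4" "bigon 2 a b 2 4 4 4"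
      using one by (auto intro!: bigon_1_1)
    moreover have "bigon 2 c d 4 4 3 4 \<or> bigon 2 c d 4 4 2 4"
      using cd bigon_mixed(1)[of c d 4 4] bigon_3_3(2)[of c d 4 4] by auto
    ultimately show ?thesis using intro by blast
  next
    case mixed
    have "bigon 2 a b 3 4 3 4" "bigon 2 a b 3 3 3 4"
      using mixed by (auto intro!: bigon_mixed)
    moreover have "bigon 2 c d 3 4 3 4 \<or> bigon 2 c d 3 4 3 3"
      using cd bigon_mixed(1)[of c d 3 4] bigon_3_3(1)[of c d 3 4] by auto
    ultimately show ?thesis using intro by blast
  next
    case three
    have "bigon 2 a b 3 4 3 3" "bigon 2 a b 3 3 3 3"
      using three by (auto intro!: bigon_3_3)
    moreover have "bigon 2 c d 3 3 3 4 \<or> bigon 2 c d 3 3 3 3"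
      using cd bigon_mixed(1)[of c d 3 3] bigon_3_3(1)[of c d 3 3] by auto
    ultimately show ?thesis using intro by blast
  qed
qed

lemma theta4_weightable_2:
  assumes sub: "subdivision G [(u, v, a), (u, v, b), (u, v, c), (u, v, d)]" and "u \<noteq> v" "bipartite G"
  shows "weightable G 2 \<or> (\<exists>a c d. a mod 4 = 1 \<and> c mod 4 = 1 \<and> d mod 4 = 1 \<and>
    subdivision G [(u, v, a), (u, v, 1), (u, v, c), (u, v, d)])"
proof -
  note par = theta4_parity[OF assms(1,3)]
  have pos: "0 < a" "0 < b" "0 < c" "0 < d"
    using subdivision_pos[OF sub] by simp_all
  have sub': "subdivision G [(u, v, b), (u, v, c), (u, v, d), (u, v, a)]"
    "subdivision G [(u, v, c), (u, v, d), (u, v, a), (u, v, b)]"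
    "subdivision G [(u, v, d), (u, v, a), (u, v, b), (u, v, c)]"
    by (rule subdivision_mset[OF sub], simp)+
  consider "even d" | "a mod 4 = 3 \<or> b mod 4 = 3 \<or> c mod 4 = 3 \<or> d mod 4 = 3"
    | "a mod 4 = 1" "b mod 4 = 1" "c mod 4 = 1" "d mod 4 = 1"
    using par by atomize_elim presburger
  then show ?thesis
  proof cases
    case 1
    then have "bigon 2 a b 4 4 4 4" "bigon 2 c d 4 4 4 4"
      using par pos by (auto intro!: bigon_even)
    then show ?thesis
      using theta4_weightableI[OF assms(1,2)] by blast
  next
    case 2
    then show ?thesis
      using theta4_weightable_2_three[OF sub assms(2,3)]
        theta4_weightable_2_three[OF sub'(1) assms(2,3)]
        theta4_weightable_2_three[OF sub'(2) assms(2,3)]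
        theta4_weightable_2_three[OF sub'(3) assms(2,3)] by blast
  next
    case 3
    show ?thesis
    proof (cases "a = 1 \<or> b = 1 \<or> c = 1 \<or> d = 1")
      case True
      then show ?thesis
        using sub sub' 3 by blast
    next
      case False
      then have "bigon 2 a b 4 4 4 4" "bigon 2 c d 4 4 4 4"
        using 3 by (auto intro!: bigon_1_1_long)
      then show ?thesis
        using theta4_weightableI[OF assms(1,2)] by blast
    qed
  qed
qed

lemma theta4_exceptional:
  assumes sub: "subdivision G [(u, v, a), (u, v, 1), (u, v, c), (u, v, d)]" and "u \<noteq> v"
    and "a mod 4 = 1" "c mod 4 = 1" "d mod 4 = 1"
  shows "\<not> weightable G 2" "weightable G 3"
proof -
  show "\<not> weightable G 2"
  proof
    assume "weightable G 2"
    then obtain x y x' y' z w z' w' S T where *: "S = x + x' + z + z'" "T = y + y' + w + w'"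
      "link 2 a x y S T" "link 2 1 x' y' S T" "link 2 c z w S T" "link 2 d z' w' S T"
      by (rule theta4_weightableE[OF assms(1,2)])
    then have "x = y" "z = w" "z' = w'" "x' = y'" "S \<noteq> T"
      using link_2_ends(1) assms link_1_iff by blast+
    then show False using * by simp
  qed
  have "a \<noteq> 1"
    using no_parallel_edges[of G u v a 1] sub by auto
  have "link 3 a 2 3 (4 + 4) (4 + 5)"
    using assms \<open>a \<noteq> 1\<close> by (intro link_3_weights) auto
  moreover have "link 3 1 2 2 (4 + 4) (4 + 5)"
    by (simp add: link_1)
  ultimately have "bigon 3 a 1 4 4 4 5"
    by (rule bigonI) auto
  moreover have "bigon 3 c d 4 5 4 4"
    using assms by (intro bigon_mono[OF bigon_1_1]) auto
  ultimately show "weightable G 3"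
    using theta4_weightableI[OF assms(1,2)] by blast
qed

section \<open>One corner of degree four\<close>

lemma pinched_weightableI:
  assumes "subdivision G [(u, v, a), (u, v, b), (u, w, c), (u, w, d), (v, w, f)]" "distinct [u, v, w]"
    and "bigon k a b \<gamma> q \<alpha> \<beta>" "bigon k c d \<alpha> q' \<gamma> \<delta>" "link k f q q' (q + \<beta>) (q' + \<delta>)"
  shows "weightable G k"
proof -
  obtain x y x' y' where "\<alpha> = x + x'" "\<beta> = y + y'"
    "link k a x y (\<gamma> + \<alpha>) (q + \<beta>)" "link k b x' y' (\<gamma> + \<alpha>) (q + \<beta>)"
    using assms(3) unfolding bigon_def by blast
  moreover obtain z t z' t' where "\<gamma> = z + z'" "\<delta> = t + t'"
    "link k c z t (\<alpha> + \<gamma>) (q' + \<delta>)" "link k d z' t' (\<alpha> + \<gamma>) (q' + \<delta>)"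
    using assms(4) unfolding bigon_def by blast
  moreover have "u \<noteq> v" "v \<noteq> u" "u \<noteq> w" "w \<noteq> u" "v \<noteq> w" "w \<noteq> v"
    using assms(2) by auto
  ultimately show ?thesis
    unfolding weightable_iff_links[OF assms(1) simple] using assms(5)
    by (intro exI[of _ "[(x, y), (x', y'), (z, t), (z', t'), (q, q')]"])
      (simp add: corner_color_def ac_simps)
qed

lemma pinched_parity:
  assumes "subdivision G [(u, v, a), (u, v, b), (u, w, c), (u, w, d), (v, w, f)]" "bipartite G"
  shows "even a \<longleftrightarrow> even b" "even c \<longleftrightarrow> even d" "(even b \<longleftrightarrow> even c) \<longleftrightarrow> even f"
  using subdivision_parity[OF assms] by auto

lemma pinched_weightable_1_iff:
  assumes sub: "subdivision G [(u, v, a), (u, v, b), (u, w, c), (u, w, d), (v, w, f)]"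
    and "distinct [u, v, w]" "bipartite G"
  shows "weightable G 1 \<longleftrightarrow> a = 2 \<and> b = 2 \<and> c = 2 \<and> d = 2 \<and> f = 2"
proof
  assume "weightable G 1"
  then obtain es where es: "list_all2 (\<lambda>(i, j, l) (x, y). link 1 l x y
      (corner_color [(u, v, a), (u, v, b), (u, w, c), (u, w, d), (v, w, f)] es i)
      (corner_color [(u, v, a), (u, v, b), (u, w, c), (u, w, d), (v, w, f)] es j))
      [(u, v, a), (u, v, b), (u, w, c), (u, w, d), (v, w, f)] es"
    unfolding weightable_iff_links[OF sub simple] by (elim exE)
  have "a \<in> {1, 2} \<and> b \<in> {1, 2} \<and> c \<in> {1, 2} \<and> d \<in> {1, 2} \<and> f = 2"
    using es assms(2) subdivision_pos[OF sub]
    by (auto simp: list_all2_Cons1 corner_color_def link_weight_1)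
  moreover have "a \<noteq> 1 \<or> b \<noteq> 1"
    using no_parallel_edges[OF sub] .
  moreover have "c \<noteq> 1 \<or> d \<noteq> 1"
    by (rule no_parallel_edges[of G u w _ _ "[(u, v, a), (u, v, b), (v, w, f)]"])
      (rule subdivision_mset[OF sub], simp)
  ultimately show "a = 2 \<and> b = 2 \<and> c = 2 \<and> d = 2 \<and> f = 2"
    using pinched_parity[OF sub assms(3)] by auto
next
  assume "a = 2 \<and> b = 2 \<and> c = 2 \<and> d = 2 \<and> f = 2"
  then have "bigon 1 a b 2 1 2 2" "bigon 1 c d 2 1 2 2" "link 1 f 1 1 (1 + 2) (1 + 2)"
    by (auto simp: link_weight_1 intro!: bigonI[of _ _ 1 1 _ _ _ _ _ 1 1])
  then show "weightable G 1"
    using pinched_weightableI[OF assms(1,2)] by blast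
qed

text \<open>There is no exceptional case here. At the corner of degree four the outer sums are at least 3, so
  each pair can be weighted regardless of the end weights of the fifth path. If the fifth path has
  length 1 modulo 4, so that it may be an edge, then one pair has even lengths, and its contribution
  is adapted so that the ends of the fifth path get different colours.\<close>

lemma pinched_weightable_2:
  assumes sub: "subdivision G [(u, v, a), (u, v, b), (u, w, c), (u, w, d), (v, w, f)]"
    and "distinct [u, v, w]" "bipartite G"
  shows "weightable G 2"
proof -
  note par = pinched_parity[OF sub assms(3)] and intro = pinched_weightableI[OF assms(1,2)]
  have pos: "0 < a" "0 < b" "0 < c" "0 < d" "0 < f"
    using subdivision_pos[OF sub] by simp_all
  obtain \<alpha> \<beta> where ab: "\<alpha> \<in> {3, 4}" "\<beta> \<in> {3, 4}"
    "\<forall>P Q. 3 \<le> P \<longrightarrow> Q \<in> {1, 2} \<longrightarrow> bigon 2 a b P Q \<alpha> \<beta>"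
    by (rule bigon_outer_large[OF par(1) pos(1,2)])
  obtain \<gamma> \<delta> where cd: "\<gamma> \<in> {3, 4}" "\<delta> \<in> {3, 4}"
    "\<forall>P Q. 3 \<le> P \<longrightarrow> Q \<in> {1, 2} \<longrightarrow> bigon 2 c d P Q \<gamma> \<delta>"
    by (rule bigon_outer_large[OF par(2) pos(3,4)])
  show ?thesis
  proof (cases "f mod 4 = 1")
    case False
    then have "link 2 f 1 2 (1 + \<beta>) (2 + \<delta>)"
      using ab(2) cd(2) pos by (intro link_not_1_mod_4) auto
    moreover have "3 \<le> \<alpha>" "3 \<le> \<gamma>"
      using ab(1) cd(1) by auto
    then have "bigon 2 a b \<gamma> 1 \<alpha> \<beta>" "bigon 2 c d \<alpha> 2 \<gamma> \<delta>"
      using ab(3) cd(3) by blast+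
    ultimately show ?thesis using intro by blast
  next
    case True
    then have "odd f" by presburger
    then consider "even a" "even b" | "even c" "even d"
      using par by blast
    then show ?thesis
    proof cases
      case 1
      \<comment> \<open>\<open>7 - \<delta>\<close> is the element of \<open>{3, 4}\<close> other than \<open>\<delta>\<close>.\<close>
      define \<beta>' where "\<beta>' = 7 - \<delta>"
      have "bigon 2 a b \<gamma> 2 4 \<beta>'"
        using 1 pos cd(1,2) by (intro bigon_even) (auto simp: \<beta>'_def)
      moreover have "bigon 2 c d 4 2 \<gamma> \<delta>"
        using cd(3) by simp
      moreover have "link 2 f 2 2 (2 + \<beta>') (2 + \<delta>)"
        using True cd(1,2) by (intro link_1_mod_4) (auto simp: \<beta>'_def)
      ultimately show ?thesis using intro by blast
    next
      case 2
      define \<delta>' where "\<delta>' = 7 - \<beta>"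
      have "bigon 2 c d \<alpha> 2 4 \<delta>'"
        using 2 pos ab(1,2) by (intro bigon_even) (auto simp: \<delta>'_def)
      moreover have "bigon 2 a b 4 2 \<alpha> \<beta>"
        using ab(3) by simp
      moreover have "link 2 f 2 2 (2 + \<beta>) (2 + \<delta>')"
        using True ab(1,2) by (intro link_1_mod_4) (auto simp: \<delta>'_def)
      ultimately show ?thesis using intro by blast
    qed
  qed
qed

section \<open>Four corners of degree three\<close>

lemma full_weightableI:
  assumes "subdivision G [(u, v, a), (u, v, b), (u', v', c), (u', v', d), (u, u', e), (v, v', f)]"
    and "distinct [u, v, u', v']"
    and "bigon k a b p q \<alpha> \<beta>" "bigon k c d p' q' \<alpha>' \<beta>'"
    and "link k e p p' (p + \<alpha>) (p' + \<alpha>')" "link k f q q' (q + \<beta>) (q' + \<beta>')"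
  shows "weightable G k"
proof -
  obtain x y x' y' where "\<alpha> = x + x'" "\<beta> = y + y'"
    "link k a x y (p + \<alpha>) (q + \<beta>)" "link k b x' y' (p + \<alpha>) (q + \<beta>)"
    using assms(3) unfolding bigon_def by blast
  moreover obtain z t z' t' where "\<alpha>' = z + z'" "\<beta>' = t + t'"
    "link k c z t (p' + \<alpha>') (q' + \<beta>')" "link k d z' t' (p' + \<alpha>') (q' + \<beta>')"
    using assms(4) unfolding bigon_def by blast
  moreover have "u \<noteq> v" "v \<noteq> u" "u \<noteq> u'" "u' \<noteq> u" "u \<noteq> v'" "v' \<noteq> u"
    "v \<noteq> u'" "u' \<noteq> v" "v \<noteq> v'" "v' \<noteq> v" "u' \<noteq> v'" "v' \<noteq> u'"
    using assms(2) by auto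
  ultimately show ?thesis
    unfolding weightable_iff_links[OF assms(1) simple] using assms(5,6)
    by (intro exI[of _ "[(x, y), (x', y'), (z, t), (z', t'), (p, p'), (q, q')]"])
      (simp add: corner_color_def ac_simps)
qed

lemma full_weightableE:
  assumes "subdivision G [(u, v, a), (u, v, b), (u', v', c), (u', v', d), (u, u', e), (v, v', f)]"
    and "distinct [u, v, u', v']" "weightable G k"
  obtains x y x' y' z t z' t' p p' q q' where
    "link k a x y (x + x' + p) (y + y' + q)" "link k b x' y' (x + x' + p) (y + y' + q)"
    "link k c z t (z + z' + p') (t + t' + q')" "link k d z' t' (z + z' + p') (t + t' + q')"
    "link k e p p' (x + x' + p) (z + z' + p')" "link k f q q' (y + y' + q) (t + t' + q')"
proof -
  have "\<exists>x y x' y' z t z' t' p p' q q'.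
    link k a x y (x + x' + p) (y + y' + q) \<and> link k b x' y' (x + x' + p) (y + y' + q) \<and>
    link k c z t (z + z' + p') (t + t' + q') \<and> link k d z' t' (z + z' + p') (t + t' + q') \<and>
    link k e p p' (x + x' + p) (z + z' + p') \<and> link k f q q' (y + y' + q) (t + t' + q')"
    using assms(2,3) unfolding weightable_iff_links[OF assms(1) simple]
    by (auto simp: list_all2_Cons1 corner_color_def ac_simps) blast
  then show thesis using that by blast
qed

lemma full_weightable_1_iff:
  assumes "subdivision G [(u, v, a), (u, v, b), (u', v', c), (u', v', d), (u, u', e), (v, v', f)]"
    and "distinct [u, v, u', v']"
  shows "weightable G 1 \<longleftrightarrow> a = 2 \<and> b = 2 \<and> c = 2 \<and> d = 2 \<and> e = 2 \<and> f = 2"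
proof
  assume "weightable G 1"
  then show "a = 2 \<and> b = 2 \<and> c = 2 \<and> d = 2 \<and> e = 2 \<and> f = 2"
    by (rule full_weightableE[OF assms])
      (use subdivision_pos[OF assms(1)] in \<open>auto simp: link_weight_1\<close>)
next
  assume *: "a = 2 \<and> b = 2 \<and> c = 2 \<and> d = 2 \<and> e = 2 \<and> f = 2"
  have "bigon 1 2 2 1 1 2 2" "link 1 2 1 1 (1 + 2) (1 + 2)"
    by (auto simp: link_weight_1 intro!: bigonI[of _ _ 1 1 _ _ _ _ _ 1 1])
  then show "weightable G 1"
    using full_weightableI[OF assms] * by blast
qed

lemma full_parity:
  assumes "subdivision G [(u, v, a), (u, v, b), (u', v', c), (u', v', d), (u, u', e), (v, v', f)]"
    and "bipartite G"
  shows "even a \<longleftrightarrow> even b" "even c \<longleftrightarrow> even d" "(even b \<longleftrightarrow> even c) \<longleftrightarrow> (even e \<longleftrightarrow> even f)"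
  using subdivision_parity[OF assms] by auto

text \<open>If neither of the two connecting paths has length 1 modulo 4, they can have the weights 2, 1 at the
  first pair and 1, 2 at the second, which suits every kind of pair. A connecting path of length 1 modulo 4 may be an edge, and then the
  pairs have to contribute different amounts at its two ends. The assumption on \<open>e\<close> and \<open>f\<close> is without
  loss of generality, by exchanging the roles of the two connecting paths.\<close>

lemma full_weightable_2_aux:
  assumes sub: "subdivision G [(u, v, a), (u, v, b), (u', v', c), (u', v', d), (u, u', e), (v, v', f)]"
    and "distinct [u, v, u', v']" "bipartite G"
    and ef: "e mod 4 = 1 \<or> f mod 4 \<noteq> 1"
    and nonexc: "\<not> (e mod 4 = 1 \<and> f mod 4 = 3 \<and>
      (a mod 4 = 1 \<and> b mod 4 = 1 \<and> (a = 1 \<or> b = 1)) \<and>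
      (c mod 4 = 1 \<and> d mod 4 = 1 \<and> (c = 1 \<or> d = 1)))"
  shows "weightable G 2"
proof -
  note intro = full_weightableI[OF assms(1,2)]
  note par = full_parity[OF assms(1,3)]
  have pos: "0 < a" "0 < b" "0 < c" "0 < d" "0 < e" "0 < f"
    using subdivision_pos[OF sub] by simp_all
  show ?thesis
  proof (cases "e mod 4 = 1")
    case False
    obtain \<alpha> \<beta> where ab: "\<alpha> \<in> {3, 4}" "\<beta> \<in> {3, 4}" "bigon 2 a b 2 1 \<alpha> \<beta>"
      by (rule bigon_outer_unequal[OF par(1) pos(1,2), of 2 1]) (auto simp: insert_commute)
    obtain \<alpha>' \<beta>' where cd: "\<alpha>' \<in> {3, 4}" "\<beta>' \<in> {3, 4}" "bigon 2 c d 1 2 \<alpha>' \<beta>'"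
      by (rule bigon_outer_unequal[OF par(2) pos(3,4), of 1 2]) auto
    have "link 2 e 2 1 (2 + \<alpha>) (1 + \<alpha>')"
      by (rule link_not_1_mod_4) (use False pos ab(1) cd(1) in auto)
    moreover have "link 2 f 1 2 (1 + \<beta>) (2 + \<beta>')"
      by (rule link_not_1_mod_4) (use False ef pos ab(2) cd(2) in auto)
    ultimately show ?thesis
      using intro ab(3) cd(3) by blast
  next
    case e: True
    then have "odd e" by presburger
    consider "even f" | "f mod 4 = 3" | "f mod 4 = 1"
      by atomize_elim presburger
    then show ?thesis
    proof cases
      case 1
      obtain \<alpha> \<beta> where ab: "\<alpha> \<in> {3, 4}" "\<beta> \<in> {3, 4}" "bigon 2 a b 2 1 \<alpha> \<beta>"
        by (rule bigon_outer_unequal[OF par(1) pos(1,2), of 2 1]) (auto simp: insert_commute)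
      obtain \<alpha>' \<beta>' where cd: "\<alpha>' \<in> {3, 4}" "\<beta>' \<in> {3, 4}" "bigon 2 c d 2 1 \<alpha>' \<beta>'"
        by (rule bigon_outer_unequal[OF par(2) pos(3,4), of 2 1]) (auto simp: insert_commute)
      consider "even a" "even b" | "even c" "even d"
        using par 1 \<open>odd e\<close> by blast
      then show ?thesis
      proof cases
        case even: 1
        \<comment> \<open>A pair of even lengths can contribute 3 as well as 4 at \<open>u\<close>, so it takes the value other
          than \<open>\<alpha>'\<close>.\<close>
        have "bigon 2 a b 2 1 (7 - \<alpha>') 4"
          using even pos cd(1) by (intro bigon_even) auto
        moreover have "link 2 e 2 2 (2 + (7 - \<alpha>')) (2 + \<alpha>')"
          using e cd(1) by (intro link_1_mod_4) auto
        moreover have "link 2 f 1 1 (1 + 4) (1 + \<beta>')"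
          using 1 pos cd(2) by (intro link_even) auto
        ultimately show ?thesis
          using intro cd(3) by blast
      next
        case even: 2
        have "bigon 2 c d 2 1 (7 - \<alpha>) 4"
          using even pos ab(1) by (intro bigon_even) auto
        moreover have "link 2 e 2 2 (2 + \<alpha>) (2 + (7 - \<alpha>))"
          using e ab(1) by (intro link_1_mod_4) auto
        moreover have "link 2 f 1 1 (1 + \<beta>) (1 + 4)"
          using 1 pos ab(2) by (intro link_even) auto
        ultimately show ?thesis
          using intro ab(3) by blast
      qed
    next
      case 2
      have le: "link 2 e 2 2 (2 + 3) (2 + 4)" "link 2 e 2 2 (2 + 4) (2 + 3)"
        using e by (auto intro!: link_1_mod_4)
      have lf: "link 2 f 2 1 (2 + \<beta>) (1 + \<beta>')" "link 2 f 1 2 (1 + \<beta>') (2 + \<beta>)"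
        if "\<beta> \<in> {2, 3, 4}" "\<beta>' \<in> {2, 3, 4}" for \<beta> \<beta>'
        using 2 that by (auto intro!: link_3_mod_4)
      \<comment> \<open>One pair contributes 4 and the other 3 at the ends of the path of length \<open>e\<close>. A pair of
        lengths 1 modulo 4 with an edge cannot be the one that contributes 3, since the outer weights
        2 and 2 are equal there.\<close>
      obtain \<beta> where ab: "\<beta> \<in> {2, 3, 4}" "bigon 2 a b 2 1 4 \<beta>"
        by (rule bigon_start_4[OF par(1) pos(1,2)])
      obtain \<beta>' where cd: "\<beta>' \<in> {2, 3, 4}" "bigon 2 c d 2 1 4 \<beta>'"
        by (rule bigon_start_4[OF par(2) pos(3,4)])
      show ?thesis
      proof (cases "a mod 4 = 1 \<and> b mod 4 = 1 \<and> (a = 1 \<or> b = 1)")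
        case True
        then have "\<not> (c mod 4 = 1 \<and> d mod 4 = 1 \<and> (c = 1 \<or> d = 1))"
          using nonexc e 2 by blast
        then obtain \<gamma> where "\<gamma> \<in> {2, 3, 4}" "bigon 2 c d 2 2 3 \<gamma>"
          by (rule bigon_start_3[OF par(2) pos(3,4)])
        then show ?thesis
          using intro[OF ab(2) _ le(2) lf(2)] ab(1) by blast
      next
        case False
        then obtain \<gamma> where "\<gamma> \<in> {2, 3, 4}" "bigon 2 a b 2 2 3 \<gamma>"
          by (rule bigon_start_3[OF par(1) pos(1,2)])
        then show ?thesis
          using intro[OF _ cd(2) le(1) lf(1)] cd(1) by blast
      qed
    next
      case 3
      \<comment> \<open>Both connecting paths may be edges: they transmit their weights, and the two pairs have to
        contribute different amounts on either side.\<close>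
      have H: "weightable G 2" if "bigon 2 a b p q \<alpha> \<beta>" "bigon 2 c d p q \<alpha>' \<beta>'"
        "p \<in> {1, 2}" "q \<in> {1, 2}" "2 \<le> \<alpha>" "2 \<le> \<beta>" "2 \<le> \<alpha>'" "2 \<le> \<beta>'" "\<alpha> \<noteq> \<alpha>'" "\<beta> \<noteq> \<beta>'"
        for p q \<alpha> \<beta> \<alpha>' \<beta>'
      proof -
        have "link 2 e p p (p + \<alpha>) (p + \<alpha>')"
          using e that by (intro link_1_mod_4) auto
        moreover have "link 2 f q q (q + \<beta>) (q + \<beta>')"
          using 3 that by (intro link_1_mod_4) auto
        ultimately show ?thesis
          using intro that by blast
      qed
      have "even a \<longleftrightarrow> even c"
        using par 3 \<open>odd e\<close> by presburger
      show ?thesis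
        using par(1)
      proof (cases rule: same_parity_cases)
        case even
        then have "even c" "even d"
          using par \<open>even a \<longleftrightarrow> even c\<close> by auto
        have "bigon 2 a b 2 2 3 3"
          using even pos by (intro bigon_even) auto
        moreover have "bigon 2 c d 2 2 4 4"
          using \<open>even c\<close> \<open>even d\<close> pos by (intro bigon_even) auto
        ultimately show ?thesis
          by (rule H) auto
      next
        case ab: one
        have ab: "bigon 2 a b 2 1 2 2" "bigon 2 a b 2 1 3 3" "bigon 2 a b 2 1 4 4"
          by (rule bigon_1_1; use ab in simp)+
        show ?thesis
          using par(2)
        proof (cases rule: same_parity_cases)
          case even
          then show ?thesis
            using \<open>even a \<longleftrightarrow> even c\<close> \<open>a mod 4 = 1\<close> by presburger
        next
          case one
          then have "bigon 2 c d 2 1 4 4" by (intro bigon_1_1) auto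
          then show ?thesis by (rule H[OF ab(2)]) auto
        next
          case mixed
          then have "bigon 2 c d 2 1 4 3" by (intro bigon_mixed) auto
          then show ?thesis by (rule H[OF ab(1)]) auto
        next
          case three
          then have "bigon 2 c d 2 1 3 3" by (intro bigon_3_3) auto
          then show ?thesis by (rule H[OF ab(3)]) auto
        qed
      next
        case ab: mixed
        have "odd a" using ab by presburger
        have ab: "bigon 2 a b 2 1 4 3" "bigon 2 a b 2 2 3 4"
          by (rule bigon_mixed; use ab in simp)+
        show ?thesis
          using par(2)
        proof (cases rule: same_parity_cases)
          case even
          then show ?thesis
            using \<open>even a \<longleftrightarrow> even c\<close> \<open>odd a\<close> by simp
        next
          case one
          then have "bigon 2 c d 2 1 2 2" by (intro bigon_1_1) auto
          then show ?thesis by (rule H[OF ab(1)]) auto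
        next
          case mixed
          then have "bigon 2 c d 2 2 4 3" by (intro bigon_mixed) auto
          then show ?thesis by (rule H[OF ab(2)]) auto
        next
          case three
          then have "bigon 2 c d 2 2 4 2" by (intro bigon_3_3) auto
          then show ?thesis by (rule H[OF ab(2)]) auto
        qed
      next
        case ab: three
        have "odd a" using ab by presburger
        have ab: "bigon 2 a b 2 1 3 3" "bigon 2 a b 2 2 2 4" "bigon 2 a b 2 2 4 2"
          by (rule bigon_3_3[OF ab]; simp)+
        show ?thesis
          using par(2)
        proof (cases rule: same_parity_cases)
          case even
          then show ?thesis
            using \<open>even a \<longleftrightarrow> even c\<close> \<open>odd a\<close> by simp
        next
          case one
          then have "bigon 2 c d 2 1 4 4" by (intro bigon_1_1) auto
          then show ?thesis by (rule H[OF ab(1)]) auto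
        next
          case mixed
          then have "bigon 2 c d 2 2 3 4" by (intro bigon_mixed) auto
          then show ?thesis by (rule H[OF ab(3)]) auto
        next
          case three
          then have "bigon 2 c d 2 2 4 2" by (intro bigon_3_3) auto
          then show ?thesis by (rule H[OF ab(2)]) auto
        qed
      qed
    qed
  qed
qed

lemma full_mirror:
  assumes "subdivision G [(u, v, a), (u, v, b), (u', v', c), (u', v', d), (u, u', e), (v, v', f)]"
  shows "subdivision G [(v, u, a), (v, u, b), (v', u', c), (v', u', d), (v, v', f), (u, u', e)]"
proof -
  have "subdivision G [(u, v, a), (u, v, b), (u', v', c), (u', v', d), (v, v', f), (u, u', e)]"
    using assms by (rule subdivision_mset) simp
  then show ?thesis
    by (rule subdivision_orient[rotated]) simp
qed

lemma full_weightable_2: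
  assumes sub: "subdivision G [(u, v, a), (u, v, b), (u', v', c), (u', v', d), (u, u', e), (v, v', f)]"
    and dist: "distinct [u, v, u', v']" and bip: "bipartite G"
  shows "weightable G 2 \<or> (\<exists>u v u' v' a d e f. distinct [u, v, u', v'] \<and>
     a mod 4 = 1 \<and> d mod 4 = 1 \<and> e mod 4 = 1 \<and> f mod 4 = 3 \<and>
     subdivision G [(u, v, a), (u, v, 1), (u', v', 1), (u', v', d), (u, u', e), (v, v', f)])"
proof -
  have main: "weightable G 2 \<or> (\<exists>u v u' v' a d e f. distinct [u, v, u', v'] \<and>
     a mod 4 = 1 \<and> d mod 4 = 1 \<and> e mod 4 = 1 \<and> f mod 4 = 3 \<and>
     subdivision G [(u, v, a), (u, v, 1), (u', v', 1), (u', v', d), (u, u', e), (v, v', f)])"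
    if sub: "subdivision G [(u, v, a), (u, v, b), (u', v', c), (u', v', d), (u, u', e), (v, v', f)]"
      and dist: "distinct [u, v, u', v']" and ef: "e mod 4 = 1 \<or> f mod 4 \<noteq> 1"
    for u v u' v' e f
  proof (cases "e mod 4 = 1 \<and> f mod 4 = 3 \<and>
      (a mod 4 = 1 \<and> b mod 4 = 1 \<and> (a = 1 \<or> b = 1)) \<and>
      (c mod 4 = 1 \<and> d mod 4 = 1 \<and> (c = 1 \<or> d = 1))")
    case True
    have "subdivision G [(u, v, b), (u, v, a), (u', v', c), (u', v', d), (u, u', e), (v, v', f)]"
      "subdivision G [(u, v, a), (u, v, b), (u', v', d), (u', v', c), (u, u', e), (v, v', f)]"
      "subdivision G [(u, v, b), (u, v, a), (u', v', d), (u', v', c), (u, u', e), (v, v', f)]"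
      by (rule subdivision_mset[OF sub], simp)+
    then show ?thesis
      using True sub dist by blast
  next
    case False
    then show ?thesis
      using full_weightable_2_aux[OF sub dist bip ef] by blast
  qed
  show ?thesis
  proof (cases "e mod 4 = 1 \<or> f mod 4 \<noteq> 1")
    case True
    then show ?thesis
      by (rule main[OF sub dist])
  next
    case False
    have "distinct [v, u, v', u']"
      using dist by auto
    then show ?thesis
      using main[OF full_mirror[OF sub]] False by blast
  qed
qed

text \<open>Each single edge forces its two connecting paths to start with different weights. A path of length
  1 modulo 4 transmits its weight and one of length 3 modulo 4 changes it, so different weights on one
  side become equal on the other. With a third weight, one end weight 3 at \<open>v\<close> suffices to
  distinguish \<open>v\<close> from \<open>u\<close>.\<close>

lemma full_exceptional:
  assumes sub: "subdivision G [(u, v, a), (u, v, 1), (u', v', 1), (u', v', d), (u, u', e), (v, v', f)]"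
    and dist: "distinct [u, v, u', v']"
    and mod: "a mod 4 = 1" "d mod 4 = 1" "e mod 4 = 1" "f mod 4 = 3"
  shows "\<not> weightable G 2" "weightable G 3"
proof -
  show "\<not> weightable G 2"
  proof
    assume "weightable G 2"
    then obtain x y x' y' z t z' t' p p' q q' where
      a: "link 2 a x y (x + x' + p) (y + y' + q)" and b: "link 2 1 x' y' (x + x' + p) (y + y' + q)"
      and c: "link 2 1 z t (z + z' + p') (t + t' + q')" and d: "link 2 d z' t' (z + z' + p') (t + t' + q')"
      and e: "link 2 e p p' (x + x' + p) (z + z' + p')" and f: "link 2 f q q' (y + y' + q) (t + t' + q')"
      by (rule full_weightableE[OF sub dist])
    have "x = y" "z' = t'" "p = p'" "q + q' = 3"
      using link_2_ends(1)[OF a] link_2_ends(1)[OF d] link_2_ends(1)[OF e] link_2_ends(2)[OF f] mod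
      by simp_all
    moreover have "x' = y'" "x + x' + p \<noteq> y + y' + q" "z = t" "z + z' + p' \<noteq> t + t' + q'"
      using b c unfolding link_1_iff by auto
    moreover have "0 < e" "0 < f"
      using mod by (auto intro: Nat.gr0I)
    then have "p \<in> {1..2}" "q \<in> {1..2}"
      using link_weights[OF e] link_weights[OF f] by auto
    ultimately show False by auto
  qed
  have "a \<noteq> 1"
    using no_parallel_edges[of G u v a 1] sub by auto
  have "link 3 a 2 3 (2 + 4) (2 + 5)"
    using mod \<open>a \<noteq> 1\<close> by (intro link_3_weights) auto
  moreover have "link 3 1 2 2 (2 + 4) (2 + 5)"
    by (simp add: link_1)
  ultimately have "bigon 3 a 1 2 2 4 5"
    by (rule bigonI) auto
  moreover have "bigon 3 1 d 2 1 3 3"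
    using mod by (intro bigon_mono[OF bigon_1_1]) auto
  moreover have "link 3 e 2 2 (2 + 4) (2 + 3)"
    using mod by (intro link_mono[OF link_1_mod_4]) auto
  moreover have "link 3 f 2 1 (2 + 5) (1 + 3)"
    using mod by (intro link_mono[OF link_3_mod_4]) auto
  ultimately show "weightable G 3"
    using full_weightableI[OF sub dist] by blast
qed

end

section \<open>The classification\<close>

lemma weightable_Suc: "weightable G k \<Longrightarrow> weightable G (Suc k)"
  unfolding weightable_def vc_edge_weighting_def by fastforce

lemma mu_eq:
  assumes "edges G \<noteq> {}" "weightable G 3"
  shows "mu G = (if weightable G 1 then 1 else if weightable G 2 then 2 else 3)"
proof -
  have "\<not> weightable G 0"
    using assms(1) by (auto simp: weightable_def vc_edge_weighting_def)
  have mu: "mu G = (LEAST k. weightable G k)"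
    by (simp add: mu_def weightable_def)
  consider "weightable G 1" | "\<not> weightable G 1" "weightable G 2"
    | "\<not> weightable G 1" "\<not> weightable G 2" by blast
  then show ?thesis
  proof cases
    case 1
    then show ?thesis
      unfolding mu using \<open>\<not> weightable G 0\<close>
      by (auto intro!: Least_equality) (metis Suc_leI gr0I)
  next
    case 2
    have "2 \<le> k" if "weightable G k" for k
      using that 2 \<open>\<not> weightable G 0\<close> by (cases "k = 0"; cases "k = 1") auto
    then show ?thesis
      unfolding mu using 2 by (auto intro!: Least_equality)
  next
    case 3
    have "3 \<le> k" if "weightable G k" for k
      using that 3 \<open>\<not> weightable G 0\<close> by (cases "k = 0"; cases "k = 1"; cases "k = 2") auto
    then show ?thesis
      unfolding mu using 3 assms(2) by (auto intro!: Least_equality)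
  qed
qed

context
  fixes G :: "'a ugraph"
  assumes simple: "simple_graph G" and bip: "bipartite G"
    and ns: "nonseparable G" and verts: "verts G = \<Union> (edges G)" and ne: "edges G \<noteq> {}"
begin

text \<open>The lengths with an edge parallel to a path of length 2 are compatible with no bipartite graph; for
  the others the shape is determined by the lengths.\<close>

lemma weightable_1_if_presented:
  assumes "presented_with G mu_one_lengths"
  shows "weightable G 1"
proof -
  obtain a b c d e f where formed: "formed_by_paths G a b c d e f" and Q: "mu_one_lengths a b c d e f"
    using assms by (auto simp: presented_with_def)
  from formed ns ne show ?thesis
  proof (cases rule: formed_by_paths_cases)
    case cycle
    then show ?thesis using Q by (auto simp: mu_one_lengths_def)
  next
    case (theta u v)
    then show ?thesis
      using Q theta_weightable_1_iff[OF simple theta(6,1)] by (auto simp: mu_one_lengths_def)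
  next
    case (theta' u v)
    then show ?thesis using Q by (auto simp: mu_one_lengths_def)
  next
    case (theta4 u v)
    then show ?thesis
      using Q theta4_weightable_1_iff[OF simple theta4(8,1)] by (auto simp: mu_one_lengths_def)
  next
    case (pinched u v w)
    then show ?thesis
      using Q pinched_parity[OF simple pinched(7) bip]
        pinched_weightable_1_iff[OF simple pinched(7,1) bip] by (auto simp: mu_one_lengths_def)
  next
    case (full u v u' v')
    then show ?thesis
      using Q full_weightable_1_iff[OF simple full(8,1)] by (auto simp: mu_one_lengths_def)
  qed
qed

lemma presented_if_weightable_1:
  assumes formed: "formed_by_paths G a b c d e f" and w: "weightable G 1"
  shows "presented_with G mu_one_lengths"
proof -
  have intro: "presented_with G mu_one_lengths"
    if "formed_by_paths G a b c d e f" "mu_one_lengths a b c d e f" for a b c d e f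
    using that unfolding presented_with_def by blast
  from formed ns ne show ?thesis
  proof (cases rule: formed_by_paths_cases)
    case (cycle u)
    then show ?thesis using cycle_not_weightable_1[OF simple] w by blast
  next
    case (theta u v)
    then show ?thesis
      using w theta_weightable_1_iff[OF simple theta(6,1)] formed_by_paths_theta[OF verts theta(6,1)]
      by (intro intro) (auto simp: mu_one_lengths_def)
  next
    case (theta' u v)
    then show ?thesis
      using w theta_weightable_1_iff[OF simple theta'(6,1)] formed_by_paths_theta[OF verts theta'(6,1)]
      by (intro intro) (auto simp: mu_one_lengths_def)
  next
    case (theta4 u v)
    then show ?thesis
      using w theta4_weightable_1_iff[OF simple theta4(8,1)] formed_by_paths_theta4[OF verts theta4(8,1)]
      by (intro intro) (auto simp: mu_one_lengths_def)
  next
    case (pinched u v w')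
    then show ?thesis
      using w pinched_weightable_1_iff[OF simple pinched(7,1) bip]
        formed_by_paths_pinched[OF verts pinched(7,1)]
      by (intro intro) (auto simp: mu_one_lengths_def)
  next
    case (full u v u' v')
    then show ?thesis
      using w full_weightable_1_iff[OF simple full(8,1)] formed_by_paths_full[OF verts full(8,1)]
      by (intro intro) (auto simp: mu_one_lengths_def)
  qed
qed

lemma exceptional_if_presented:
  assumes "presented_with G mu_three_lengths"
  shows "\<not> weightable G 2 \<and> weightable G 3"
proof -
  obtain a b c d e f where formed: "formed_by_paths G a b c d e f"
    and Q: "mu_three_lengths a b c d e f"
    using assms by (auto simp: presented_with_def)
  from formed ns ne show ?thesis
  proof (cases rule: formed_by_paths_cases)
    case (cycle u)
    then have "(a + b + c + d + e + f) mod 4 = 2"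
      using Q by (auto simp: mu_three_lengths_def)
    then show ?thesis using cycle_exceptional[OF simple cycle(2)] by blast
  next
    case (theta u v)
    then have "b = 1" "a mod 4 = 1" "(e + f) mod 4 = 1"
      using Q by (auto simp: mu_three_lengths_def)
    then show ?thesis
      using theta_exceptional[OF simple _ theta(1)] theta(6) by blast
  next
    case (theta' u v)
    then show ?thesis using Q by (auto simp: mu_three_lengths_def)
  next
    case (theta4 u v)
    then have "b = 1" "a mod 4 = 1" "c mod 4 = 1" "d mod 4 = 1"
      using Q by (auto simp: mu_three_lengths_def)
    then show ?thesis
      using theta4_exceptional[OF simple _ theta4(1)] theta4(8) by blast
  next
    case (pinched u v w)
    then show ?thesis using Q by (auto simp: mu_three_lengths_def)
  next
    case (full u v u' v')
    then have "b = 1" "c = 1" "a mod 4 = 1" "d mod 4 = 1" "e mod 4 = 1" "f mod 4 = 3"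
      using Q by (auto simp: mu_three_lengths_def)
    then show ?thesis
      using full_exceptional[OF simple _ full(1)] full(8) by blast
  qed
qed

text \<open>The given presentation need not itself satisfy one of the conditions. The shape lemmas supply one
  that does, after the paths have been renamed.\<close>

lemma presented_if_not_weightable_2:
  assumes formed: "formed_by_paths G a b c d e f" and no: "\<not> weightable G 2"
  shows "presented_with G mu_three_lengths"
proof -
  have intro: "presented_with G mu_three_lengths"
    if "formed_by_paths G a b c d e f" "mu_three_lengths a b c d e f" for a b c d e f
    using that unfolding presented_with_def by blast
  have theta_case: "presented_with G mu_three_lengths"
    if uv: "u \<noteq> v" and sub: "subdivision G [(u, v, l), (u, v, m), (u, v, n)]" for u v l m n
  proof -
    obtain a g where "a mod 4 = 1" "g mod 4 = 1" "subdivision G [(u, v, a), (u, v, 1), (u, v, g)]"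
      using theta_weightable_2[OF simple sub uv bip] no by blast
    then show ?thesis
      using formed_by_paths_theta[OF verts _ uv]
      by (intro intro[of a 1 0 0 0 g]) (auto simp: mu_three_lengths_def)
  qed
  from formed ns ne show ?thesis
  proof (cases rule: formed_by_paths_cases)
    case (cycle u)
    then have "(a + b + c + d + e + f) mod 4 = 2"
      using cycle_weightable_2[OF simple cycle(2) bip] no by blast
    then show ?thesis
      using formed_by_paths_cycle[OF verts cycle(2)]
      by (intro intro[of 0 0 0 0 0 "a + b + c + d + e + f"]) (auto simp: mu_three_lengths_def)
  next
    case (theta u v)
    show ?thesis by (rule theta_case[OF theta(1,6)])
  next
    case (theta' u v)
    show ?thesis by (rule theta_case[OF theta'(1,6)])
  next
    case (theta4 u v)
    then obtain a c d where *: "a mod 4 = 1" "c mod 4 = 1" "d mod 4 = 1"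
      "subdivision G [(u, v, a), (u, v, 1), (u, v, c), (u, v, d)]"
      using theta4_weightable_2[OF simple theta4(8,1) bip] no by blast
    show ?thesis
      using formed_by_paths_theta4[OF verts *(4) theta4(1)] *
      by (intro intro[of a 1 c d 0 0]) (auto simp: mu_three_lengths_def)
  next
    case (pinched u v w)
    then show ?thesis using pinched_weightable_2[OF simple pinched(7,1) bip] no by blast
  next
    case (full u v u' v')
    obtain u v u' v' a d e f where *: "distinct [u, v, u', v']"
      "a mod 4 = 1" "d mod 4 = 1" "e mod 4 = 1" "f mod 4 = 3"
      "subdivision G [(u, v, a), (u, v, 1), (u', v', 1), (u', v', d), (u, u', e), (v, v', f)]"
      using full_weightable_2[OF simple full(8,1) bip] no by blast
    show ?thesis
      using formed_by_paths_full[OF verts *(6,1)] *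
      by (intro intro[of a 1 1 d e f]) (auto simp: mu_three_lengths_def)
  qed
qed

end

theorem theorem4p3:
  fixes G :: "'a ugraph" and a b c d e f r :: nat
  assumes "simple_graph G"
    and "bipartite G"
    and "gen_polygon_tree r G" and "r \<le> 3"
    and "formed_by_paths G a b c d e f"
  shows "(mu G = 1 \<longleftrightarrow> presented_with G mu_one_lengths) \<and>
    (mu G = 3 \<longleftrightarrow> presented_with G mu_three_lengths) \<and>
    (\<not> presented_with G mu_one_lengths \<and> \<not> presented_with G mu_three_lengths \<longrightarrow> mu G = 2)"
proof -
  have G: "nonseparable G" "verts G = \<Union> (edges G)" "edges G \<noteq> {}"
    using gen_polygon_tree_nonseparable[OF assms(3)] by auto
  have one: "weightable G 1 \<longleftrightarrow> presented_with G mu_one_lengths"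
    using weightable_1_if_presented[OF assms(1,2) G]
      presented_if_weightable_1[OF assms(1,2) G assms(5)] by blast
  have three: "\<not> weightable G 2 \<longleftrightarrow> presented_with G mu_three_lengths"
    using exceptional_if_presented[OF assms(1,2) G]
      presented_if_not_weightable_2[OF assms(1,2) G assms(5)] by blast
  have up: "weightable G 1 \<Longrightarrow> weightable G 2" "weightable G 2 \<Longrightarrow> weightable G 3"
    using weightable_Suc[of G 1] weightable_Suc[of G 2] by (simp_all add: eval_nat_numeral)
  have "weightable G 3"
    using up(2) three exceptional_if_presented[OF assms(1,2) G] by blast
  then have "mu G = (if weightable G 1 then 1 else if weightable G 2 then 2 else 3)"
    by (rule mu_eq[OF G(3)])
  then show ?thesis
    using one three up(1) by auto
qed

end
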